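(* Let $R$ be a commutative ring with identity, let $A$ be an associative $R$-algebra that is free as an $R$-module, let $I$ be a (two-sided) ideal of $A$, and let $M$ be a left $A$-module that is free as an $R$-module. Then $\operatorname{Tor}^{(A,R)}_k(A/I,M)\cong \operatorname{Tor}^A_k(A/I,M)$ for all $k\ge 0$.
   Context: $\operatorname{Tor}^A_k$ denotes the usual Tor groups over $A$. An $A$-module $P$ is $(A,R)$-projective if for every epimorphism $f\colon X\to Y$ of $A$-modules that is split as an epimorphism of $R$-modules, $\operatorname{Hom}_A(P,f)$ is surjective. An $(A,R)$-projective resolution of an $A$-module $M$ is an exact complex $P_\bullet\twoheadrightarrow M$ of $A$-modules with all $P_k$ $(A,R)$-projective, which is split as a complex of $R$-modules. Every $A$-module $M$ has such a resolution, e.g. the (unnormalized) bar resolution with terms $\beta_k(A,R,M)=A^{\otimes_R(k+1)}\otimes_R M$, $k\ge 0$, and the usual differentials. For a right $A$-module $N$ and a left $A$-module $M$, the relative torsion groups are $\operatorname{Tor}^{(A,R)}_k(N,M)=H_k(N\otimes_A P_\bullet)$, $k\ge 0$, where $P_\bullet$ is any $(A,R)$-projective resolution of $M$ (the result is independent of the choice). *)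

theory Defs
  imports "HOL-Algebra.Free_Abelian_Groups" "HOL-Algebra.Module" "HOL-Algebra.QuotRing"
begin

section \<open>Algebras and modules over noncommutative rings\<close>

text \<open>
  The locale \<^locale>\<open>algebra\<close> of the library covers only commutative algebras, and
  \<^locale>\<open>module\<close> only modules over commutative rings.  Algebras and modules below are
  unital.  In the record of a module the fields \<open>mult\<close> and \<open>one\<close> are irrelevant.
\<close>

definition assoc_algebra :: "'r ring \<Rightarrow> ('r, 'a) module \<Rightarrow> bool" where
  "assoc_algebra R A \<longleftrightarrow> module R A \<and> ring A \<and>
     (\<forall>r\<in>carrier R. \<forall>a\<in>carrier A. \<forall>b\<in>carrier A.
        r \<odot>\<^bsub>A\<^esub> (a \<otimes>\<^bsub>A\<^esub> b) = (r \<odot>\<^bsub>A\<^esub> a) \<otimes>\<^bsub>A\<^esub> b \<and>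
        r \<odot>\<^bsub>A\<^esub> (a \<otimes>\<^bsub>A\<^esub> b) = a \<otimes>\<^bsub>A\<^esub> (r \<odot>\<^bsub>A\<^esub> b))"

locale left_module = R?: ring R + M?: abelian_group M
  for R :: "('a, 'c) ring_scheme" (structure) and M :: "('a, 'm, 'd) module_scheme" (structure) +
  assumes smult_closed [simp, intro]:
      "\<lbrakk>a \<in> carrier R; x \<in> carrier M\<rbrakk> \<Longrightarrow> a \<odot>\<^bsub>M\<^esub> x \<in> carrier M"
    and smult_l_distr:
      "\<lbrakk>a \<in> carrier R; b \<in> carrier R; x \<in> carrier M\<rbrakk> \<Longrightarrow>
       (a \<oplus> b) \<odot>\<^bsub>M\<^esub> x = a \<odot>\<^bsub>M\<^esub> x \<oplus>\<^bsub>M\<^esub> b \<odot>\<^bsub>M\<^esub> x"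
    and smult_r_distr:
      "\<lbrakk>a \<in> carrier R; x \<in> carrier M; y \<in> carrier M\<rbrakk> \<Longrightarrow>
       a \<odot>\<^bsub>M\<^esub> (x \<oplus>\<^bsub>M\<^esub> y) = a \<odot>\<^bsub>M\<^esub> x \<oplus>\<^bsub>M\<^esub> a \<odot>\<^bsub>M\<^esub> y"
    and smult_assoc:
      "\<lbrakk>a \<in> carrier R; b \<in> carrier R; x \<in> carrier M\<rbrakk> \<Longrightarrow>
       (a \<otimes> b) \<odot>\<^bsub>M\<^esub> x = a \<odot>\<^bsub>M\<^esub> (b \<odot>\<^bsub>M\<^esub> x)"
    and smult_one [simp]:
      "x \<in> carrier M \<Longrightarrow> \<one> \<odot>\<^bsub>M\<^esub> x = x"

text \<open>A right module uses the same record; \<open>a \<odot>\<^bsub>N\<^esub> x\<close> then stands for \<open>x \<cdot> a\<close>.\<close>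

locale right_module = R?: ring R + N?: abelian_group N
  for R :: "('a, 'c) ring_scheme" (structure) and N :: "('a, 'n, 'd) module_scheme" (structure) +
  assumes smult_closed [simp, intro]:
      "\<lbrakk>a \<in> carrier R; x \<in> carrier N\<rbrakk> \<Longrightarrow> a \<odot>\<^bsub>N\<^esub> x \<in> carrier N"
    and smult_l_distr:
      "\<lbrakk>a \<in> carrier R; b \<in> carrier R; x \<in> carrier N\<rbrakk> \<Longrightarrow>
       (a \<oplus> b) \<odot>\<^bsub>N\<^esub> x = a \<odot>\<^bsub>N\<^esub> x \<oplus>\<^bsub>N\<^esub> b \<odot>\<^bsub>N\<^esub> x"
    and smult_r_distr:
      "\<lbrakk>a \<in> carrier R; x \<in> carrier N; y \<in> carrier N\<rbrakk> \<Longrightarrow>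
       a \<odot>\<^bsub>N\<^esub> (x \<oplus>\<^bsub>N\<^esub> y) = a \<odot>\<^bsub>N\<^esub> x \<oplus>\<^bsub>N\<^esub> a \<odot>\<^bsub>N\<^esub> y"
    and smult_assoc:
      "\<lbrakk>a \<in> carrier R; b \<in> carrier R; x \<in> carrier N\<rbrakk> \<Longrightarrow>
       (a \<otimes> b) \<odot>\<^bsub>N\<^esub> x = b \<odot>\<^bsub>N\<^esub> (a \<odot>\<^bsub>N\<^esub> x)"
    and smult_one [simp]:
      "x \<in> carrier N \<Longrightarrow> \<one> \<odot>\<^bsub>N\<^esub> x = x"

lemma abelian_group_cong:
  assumes "abelian_group G" and "carrier H = carrier G" "add H = add G" "\<zero>\<^bsub>H\<^esub> = \<zero>\<^bsub>G\<^esub>"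
  shows "abelian_group H"
proof -
  interpret abelian_group G by fact
  show ?thesis
    by (rule abelian_groupI) (use assms in \<open>auto simp: a_ac intro: bexI[of _ "\<ominus>\<^bsub>G\<^esub> _"] l_neg\<close>)
qed

definition quotient_right_module :: "('r, 'a) module \<Rightarrow> 'a set \<Rightarrow> ('a, 'a set) module" where
  "quotient_right_module A I =
     \<lparr>carrier = carrier (A Quot I), mult = mult (A Quot I), one = \<one>\<^bsub>A Quot I\<^esub>,
      zero = \<zero>\<^bsub>A Quot I\<^esub>, add = add (A Quot I),
      smult = (\<lambda>a X. X \<otimes>\<^bsub>A Quot I\<^esub> (I +>\<^bsub>A\<^esub> a))\<rparr>"

lemma quotient_right_module:
  fixes A :: "('r, 'a) module"
  assumes "ideal I A"
  shows "right_module A (quotient_right_module A I)"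
proof -
  interpret ideal I A by fact
  interpret Q: ring "A Quot I" by (rule quotient_is_ring)
  interpret h: ring_hom_ring A "A Quot I" "(+>\<^bsub>A\<^esub>) I" by (rule rcos_ring_hom_ring)
  have "abelian_group (quotient_right_module A I)"
    by (rule abelian_group_cong[OF Q.abelian_group_axioms]) (simp_all add: quotient_right_module_def)
  then show ?thesis
    by (auto simp: right_module_def right_module_axioms_def ring_axioms
        quotient_right_module_def Q.r_distr Q.l_distr Q.m_assoc)
qed

definition restrict_scalars ::
    "'r ring \<Rightarrow> ('r, 'a) module \<Rightarrow> ('a, 'm) module \<Rightarrow> ('r, 'm) module" where
  "restrict_scalars R A M =
     \<lparr>carrier = carrier M, mult = mult M, one = \<one>\<^bsub>M\<^esub>, zero = \<zero>\<^bsub>M\<^esub>, add = add M,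
      smult = (\<lambda>r x. (r \<odot>\<^bsub>A\<^esub> \<one>\<^bsub>A\<^esub>) \<odot>\<^bsub>M\<^esub> x)\<rparr>"

lemma module_restrict_scalars:
  assumes "assoc_algebra R A" "left_module A M"
  shows "module R (restrict_scalars R A M)"
proof -
  interpret RA: module R A using assms by (simp add: assoc_algebra_def)
  interpret M: left_module A M by fact
  have "abelian_group (restrict_scalars R A M)"
    by (rule abelian_group_cong[OF M.M.abelian_group_axioms]) (simp_all add: restrict_scalars_def)
  moreover have "(r \<otimes>\<^bsub>R\<^esub> s) \<odot>\<^bsub>A\<^esub> \<one>\<^bsub>A\<^esub> = (r \<odot>\<^bsub>A\<^esub> \<one>\<^bsub>A\<^esub>) \<otimes>\<^bsub>A\<^esub> (s \<odot>\<^bsub>A\<^esub> \<one>\<^bsub>A\<^esub>)"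
    if "r \<in> carrier R" "s \<in> carrier R" for r s
  proof -
    have "(r \<odot>\<^bsub>A\<^esub> \<one>\<^bsub>A\<^esub>) \<otimes>\<^bsub>A\<^esub> (s \<odot>\<^bsub>A\<^esub> \<one>\<^bsub>A\<^esub>) = r \<odot>\<^bsub>A\<^esub> (\<one>\<^bsub>A\<^esub> \<otimes>\<^bsub>A\<^esub> (s \<odot>\<^bsub>A\<^esub> \<one>\<^bsub>A\<^esub>))"
      using assms(1) that unfolding assoc_algebra_def
      by (metis M.R.one_closed RA.smult_closed)
    then show ?thesis
      using that by (simp add: RA.smult_assoc1)
  qed
  ultimately show ?thesis
    by (auto simp: module_def module_axioms_def RA.R.cring_axioms restrict_scalars_def
        RA.smult_l_distr M.smult_l_distr M.smult_r_distr M.smult_assoc)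
qed

definition linear_maps ::
    "('k, 'c) ring_scheme \<Rightarrow> ('k, 'x) module \<Rightarrow> ('k, 'y) module \<Rightarrow> ('x \<Rightarrow> 'y) set" where
  "linear_maps K X Y = {f \<in> carrier X \<rightarrow> carrier Y.
     (\<forall>x\<in>carrier X. \<forall>y\<in>carrier X. f (x \<oplus>\<^bsub>X\<^esub> y) = f x \<oplus>\<^bsub>Y\<^esub> f y) \<and>
     (\<forall>a\<in>carrier K. \<forall>x\<in>carrier X. f (a \<odot>\<^bsub>X\<^esub> x) = a \<odot>\<^bsub>Y\<^esub> f x)}"

definition is_basis :: "'r ring \<Rightarrow> ('r, 'm) module \<Rightarrow> 'm set \<Rightarrow> bool" where
  "is_basis R M B \<longleftrightarrow> B \<subseteq> carrier M \<and>
     (\<forall>x\<in>carrier M. \<exists>!c. (\<forall>b\<in>B. c b \<in> carrier R) \<and> (\<forall>b. b \<notin> B \<longrightarrow> c b = \<zero>\<^bsub>R\<^esub>) \<and>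
        finite {b. c b \<noteq> \<zero>\<^bsub>R\<^esub>} \<and> x = (\<Oplus>\<^bsub>M\<^esub>b\<in>{b. c b \<noteq> \<zero>\<^bsub>R\<^esub>}. c b \<odot>\<^bsub>M\<^esub> b))"

definition free_module :: "'r ring \<Rightarrow> ('r, 'm) module \<Rightarrow> bool" where
  "free_module R M \<longleftrightarrow> (\<exists>B. is_basis R M B)"


section \<open>Projective and relatively projective modules\<close>

text \<open>
  HOL cannot quantify over all types inside a definition, so the test modules \<open>X\<close> and \<open>Y\<close> in
  the lifting properties are those with elements in a fixed type, which depends only on the
  types of the elements of \<open>A\<close> and \<open>P\<close>: sets of lists of pairs \<open>(a, p)\<close>.  Such a list is read
  as a formal combination of elements of \<open>P\<close>, so that every quotient of the free module on \<open>P\<close>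
  is isomorphic to a module of this kind.  The theorems \<open>projective_lift\<close> and
  \<open>rel_projective_lift\<close> below show that the lifting property then holds against test modules of
  arbitrary types.
\<close>

type_synonym ('a, 'p) test = "('a \<times> 'p) list set"

definition projective :: "('r, 'a) module \<Rightarrow> ('a, 'p) module \<Rightarrow> bool" where
  "projective A P \<longleftrightarrow> left_module A P \<and>
     (\<forall>(X :: ('a, ('a, 'p) test) module) (Y :: ('a, ('a, 'p) test) module) f g.
        left_module A X \<and> left_module A Y \<and>
        f \<in> linear_maps A X Y \<and> f ` carrier X = carrier Y \<and> g \<in> linear_maps A P Y \<longrightarrow>
        (\<exists>h\<in>linear_maps A P X. \<forall>p\<in>carrier P. f (h p) = g p))"

definition R_split_epi ::
    "'r ring \<Rightarrow> ('r, 'a) module \<Rightarrow> ('a, 'x) module \<Rightarrow> ('a, 'y) module \<Rightarrow> ('x \<Rightarrow> 'y) \<Rightarrow> bool" where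
  "R_split_epi R A X Y f \<longleftrightarrow>
     (\<exists>s\<in>linear_maps R (restrict_scalars R A Y) (restrict_scalars R A X).
        \<forall>y\<in>carrier Y. f (s y) = y)"

definition rel_projective :: "'r ring \<Rightarrow> ('r, 'a) module \<Rightarrow> ('a, 'p) module \<Rightarrow> bool" where
  "rel_projective R A P \<longleftrightarrow> left_module A P \<and>
     (\<forall>(X :: ('a, ('a, 'p) test) module) (Y :: ('a, ('a, 'p) test) module) f g.
        left_module A X \<and> left_module A Y \<and>
        f \<in> linear_maps A X Y \<and> f ` carrier X = carrier Y \<and> R_split_epi R A X Y f \<and>
        g \<in> linear_maps A P Y \<longrightarrow>
        (\<exists>h\<in>linear_maps A P X. \<forall>p\<in>carrier P. f (h p) = g p))"

lemma linear_maps_comp: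
  "f \<in> linear_maps K X Y \<Longrightarrow> g \<in> linear_maps K Y W \<Longrightarrow> (\<lambda>x. g (f x)) \<in> linear_maps K X W"
  by (auto simp: linear_maps_def Pi_iff)

lemma linear_maps_restrict:
  assumes "assoc_algebra R A" "f \<in> linear_maps A X Y"
  shows "f \<in> linear_maps R (restrict_scalars R A X) (restrict_scalars R A Y)"
proof -
  interpret RA: module R A using assms by (simp add: assoc_algebra_def)
  interpret ring A using assms by (simp add: assoc_algebra_def)
  show ?thesis
    using assms(2) by (auto simp: linear_maps_def restrict_scalars_def)
qed

definition transport :: "('x \<Rightarrow> 'y) \<Rightarrow> ('a, 'x) module \<Rightarrow> ('a, 'y) module" where
  "transport c X = (let i = inv_into (carrier X) c in
     \<lparr>carrier = c ` carrier X, mult = undefined, one = undefined, zero = c \<zero>\<^bsub>X\<^esub>,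
      add = (\<lambda>u v. c (i u \<oplus>\<^bsub>X\<^esub> i v)), smult = (\<lambda>a u. c (a \<odot>\<^bsub>X\<^esub> i u))\<rparr>)"

lemma transport_module:
  assumes "left_module A X" and c: "inj_on c (carrier X)"
  shows "left_module A (transport c X)"
    and "c \<in> linear_maps A X (transport c X)"
    and "inv_into (carrier X) c \<in> linear_maps A (transport c X) X"
    and "\<And>x. x \<in> carrier X \<Longrightarrow> inv_into (carrier X) c (c x) = x"
proof -
  interpret left_module A X by fact
  show i: "inv_into (carrier X) c (c x) = x" if "x \<in> carrier X" for x
    using c that by simp
  note defs = transport_def Let_def i
  show "c \<in> linear_maps A X (transport c X)"
    "inv_into (carrier X) c \<in> linear_maps A (transport c X) X"
    by (auto simp: linear_maps_def defs)
  have "abelian_group (transport c X)"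
  proof (rule abelian_groupI)
    fix u assume "u \<in> carrier (transport c X)"
    then obtain x where "x \<in> carrier X" "u = c x" by (auto simp: defs)
    then show "\<exists>v\<in>carrier (transport c X). v \<oplus>\<^bsub>transport c X\<^esub> u = \<zero>\<^bsub>transport c X\<^esub>"
      by (auto simp: defs M.l_neg intro!: bexI[of _ "\<ominus>\<^bsub>X\<^esub> x"])
  qed (auto simp: defs M.a_ac)
  then show "left_module A (transport c X)"
    by (auto simp: left_module_def left_module_axioms_def R.ring_axioms defs
        smult_l_distr smult_r_distr smult_assoc)
qed

text \<open>
  The submodule of \<open>X \<times> P\<close> generated by the pairs \<open>(\<sigma> p, p)\<close> for a map \<open>\<sigma> : P \<rightarrow> X\<close>, with
  elements written as values of formal combinations; it serves as a test module.
\<close>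

context
  fixes A :: "('r, 'a) module" and P :: "('a, 'p) module" and X :: "('a, 'x) module"
    and \<sigma> :: "'p \<Rightarrow> 'x"
begin

private fun val1 :: "('a \<times> 'p) list \<Rightarrow> 'x" where
  "val1 [] = \<zero>\<^bsub>X\<^esub>"
| "val1 ((a, p) # l) = a \<odot>\<^bsub>X\<^esub> \<sigma> p \<oplus>\<^bsub>X\<^esub> val1 l"

private fun val2 :: "('a \<times> 'p) list \<Rightarrow> 'p" where
  "val2 [] = \<zero>\<^bsub>P\<^esub>"
| "val2 ((a, p) # l) = a \<odot>\<^bsub>P\<^esub> p \<oplus>\<^bsub>P\<^esub> val2 l"

private definition combs :: "('a \<times> 'p) list set" where
  "combs = lists (carrier A \<times> carrier P)"

private definition Z :: "('a, 'x \<times> 'p) module" where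
  "Z = \<lparr>carrier = (\<lambda>l. (val1 l, val2 l)) ` combs, mult = undefined, one = undefined,
        zero = (\<zero>\<^bsub>X\<^esub>, \<zero>\<^bsub>P\<^esub>), add = (\<lambda>u v. (fst u \<oplus>\<^bsub>X\<^esub> fst v, snd u \<oplus>\<^bsub>P\<^esub> snd v)),
        smult = (\<lambda>a u. (a \<odot>\<^bsub>X\<^esub> fst u, a \<odot>\<^bsub>P\<^esub> snd u))\<rparr>"

lemma lifting_data:
  fixes W :: "('a, 'w) module"
  assumes P: "left_module A P" and X: "left_module A X" and W: "left_module A W"
    and \<sigma>: "\<sigma> \<in> carrier P \<rightarrow> carrier X"
    and f: "f \<in> linear_maps A X W" and g: "g \<in> linear_maps A P W"
    and fg: "\<And>p. p \<in> carrier P \<Longrightarrow> f (\<sigma> p) = g p"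
  obtains X' Y' :: "('a, ('a, 'p) test) module" and f' g' \<tau> \<delta> where
    "left_module A X'" "left_module A Y'" "f' \<in> linear_maps A X' Y'"
    "f' ` carrier X' = carrier Y'" "g' \<in> linear_maps A P Y'"
    "\<tau> \<in> linear_maps A X' X" "\<forall>p\<in>carrier P. \<delta> (g' p) = p"
    "\<forall>z\<in>carrier X'. f (\<tau> z) = g (\<delta> (f' z))"
    "\<forall>R. assoc_algebra R A \<and>
       \<sigma> \<in> linear_maps R (restrict_scalars R A P) (restrict_scalars R A X) \<longrightarrow>
       R_split_epi R A X' Y' f'"
proof -
  interpret P: left_module A P by fact
  interpret X: left_module A X by fact
  have combs [simp]: "[] \<in> combs"
    "x # l \<in> combs \<longleftrightarrow> fst x \<in> carrier A \<and> snd x \<in> carrier P \<and> l \<in> combs"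
    "l @ l' \<in> combs \<longleftrightarrow> l \<in> combs \<and> l' \<in> combs" for x l l'
    by (auto simp: combs_def mem_Times_iff)
  have combs_map: "map (\<lambda>(b, p). (a \<otimes>\<^bsub>A\<^esub> b, p)) l \<in> combs" if "a \<in> carrier A" "l \<in> combs" for a l
    using that by (induction l) auto
  have \<sigma>c [simp]: "\<sigma> p \<in> carrier X" if "p \<in> carrier P" for p
    using \<sigma> that by auto
  have cl: "val1 l \<in> carrier X" "val2 l \<in> carrier P" if "l \<in> combs" for l
    using that by (induction l) auto
  have app: "val1 (l @ l') = val1 l \<oplus>\<^bsub>X\<^esub> val1 l'" "val2 (l @ l') = val2 l \<oplus>\<^bsub>P\<^esub> val2 l'"
    if "l \<in> combs" "l' \<in> combs" for l l'
    using that cl(1)[OF that(2)] cl(2)[OF that(2)] cl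
    by (induction l) (auto simp: P.M.a_assoc X.M.a_assoc)
  have z0: "a \<odot>\<^bsub>X\<^esub> \<zero>\<^bsub>X\<^esub> = \<zero>\<^bsub>X\<^esub>" "a \<odot>\<^bsub>P\<^esub> \<zero>\<^bsub>P\<^esub> = \<zero>\<^bsub>P\<^esub>" if "a \<in> carrier A" for a
    using X.smult_r_distr[OF that, of "\<zero>\<^bsub>X\<^esub>" "\<zero>\<^bsub>X\<^esub>"] P.smult_r_distr[OF that, of "\<zero>\<^bsub>P\<^esub>" "\<zero>\<^bsub>P\<^esub>"] that
    by auto
  have sm: "val1 (map (\<lambda>(b, p). (a \<otimes>\<^bsub>A\<^esub> b, p)) l) = a \<odot>\<^bsub>X\<^esub> val1 l"
    "val2 (map (\<lambda>(b, p). (a \<otimes>\<^bsub>A\<^esub> b, p)) l) = a \<odot>\<^bsub>P\<^esub> val2 l"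
    if "a \<in> carrier A" "l \<in> combs" for a l
    using that(2) that(1) cl
    by (induction l) (auto simp: z0 X.smult_assoc P.smult_assoc
        X.smult_r_distr P.smult_r_distr)
  have Zcar: "u \<in> carrier Z \<longleftrightarrow> (\<exists>l\<in>combs. u = (val1 l, val2 l))" for u
    by (auto simp: Z_def)
  have Zsub: "fst u \<in> carrier X" "snd u \<in> carrier P" if "u \<in> carrier Z" for u
    using that cl by (auto simp: Zcar)
  have Zadd: "u \<oplus>\<^bsub>Z\<^esub> v = (fst u \<oplus>\<^bsub>X\<^esub> fst v, snd u \<oplus>\<^bsub>P\<^esub> snd v)"
    and Zsm: "a \<odot>\<^bsub>Z\<^esub> u = (a \<odot>\<^bsub>X\<^esub> fst u, a \<odot>\<^bsub>P\<^esub> snd u)" and Z0: "\<zero>\<^bsub>Z\<^esub> = (\<zero>\<^bsub>X\<^esub>, \<zero>\<^bsub>P\<^esub>)" for u v a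
    by (auto simp: Z_def)
  have Zaddc: "u \<oplus>\<^bsub>Z\<^esub> v \<in> carrier Z" if uv: "u \<in> carrier Z" "v \<in> carrier Z" for u v
  proof -
    obtain l l' where l: "l \<in> combs" "u = (val1 l, val2 l)" "l' \<in> combs" "v = (val1 l', val2 l')"
      using uv by (auto simp: Zcar)
    then have "l @ l' \<in> combs" "u \<oplus>\<^bsub>Z\<^esub> v = (val1 (l @ l'), val2 (l @ l'))"
      by (auto simp: Zadd app)
    then show ?thesis by (auto simp: Zcar)
  qed
  have Zsmc: "a \<odot>\<^bsub>Z\<^esub> u \<in> carrier Z" if au: "a \<in> carrier A" "u \<in> carrier Z" for a u
  proof -
    obtain l where l: "l \<in> combs" "u = (val1 l, val2 l)"
      using au by (auto simp: Zcar)
    then have "map (\<lambda>(b, p). (a \<otimes>\<^bsub>A\<^esub> b, p)) l \<in> combs"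
      "a \<odot>\<^bsub>Z\<^esub> u = (val1 (map (\<lambda>(b, p). (a \<otimes>\<^bsub>A\<^esub> b, p)) l), val2 (map (\<lambda>(b, p). (a \<otimes>\<^bsub>A\<^esub> b, p)) l))"
      using au by (auto simp: Zsm sm combs_map)
    then show ?thesis by (auto simp: Zcar)
  qed
  have Z0c: "\<zero>\<^bsub>Z\<^esub> \<in> carrier Z"
    unfolding Zcar Z0 by (rule bexI[of _ "[]"]) auto
  have neg: "(\<ominus>\<^bsub>A\<^esub> \<one>\<^bsub>A\<^esub>) \<odot>\<^bsub>X\<^esub> x \<oplus>\<^bsub>X\<^esub> x = \<zero>\<^bsub>X\<^esub>" if "x \<in> carrier X" for x
    using X.smult_l_distr[of "\<ominus>\<^bsub>A\<^esub> \<one>\<^bsub>A\<^esub>" "\<one>\<^bsub>A\<^esub>" x] X.smult_l_distr[of "\<zero>\<^bsub>A\<^esub>" "\<zero>\<^bsub>A\<^esub>" x] that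
    by (auto simp: P.R.l_neg)
  have neg': "(\<ominus>\<^bsub>A\<^esub> \<one>\<^bsub>A\<^esub>) \<odot>\<^bsub>P\<^esub> x \<oplus>\<^bsub>P\<^esub> x = \<zero>\<^bsub>P\<^esub>" if "x \<in> carrier P" for x
    using P.smult_l_distr[of "\<ominus>\<^bsub>A\<^esub> \<one>\<^bsub>A\<^esub>" "\<one>\<^bsub>A\<^esub>" x] P.smult_l_distr[of "\<zero>\<^bsub>A\<^esub>" "\<zero>\<^bsub>A\<^esub>" x] that
    by (auto simp: P.R.l_neg)
  have Zab: "abelian_group Z"
  proof (rule abelian_groupI)
    fix u assume u: "u \<in> carrier Z"
    show "\<exists>v\<in>carrier Z. v \<oplus>\<^bsub>Z\<^esub> u = \<zero>\<^bsub>Z\<^esub>"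
    proof (rule bexI)
      show "(\<ominus>\<^bsub>A\<^esub> \<one>\<^bsub>A\<^esub>) \<odot>\<^bsub>Z\<^esub> u \<in> carrier Z" by (rule Zsmc) (auto simp: u)
      show "(\<ominus>\<^bsub>A\<^esub> \<one>\<^bsub>A\<^esub>) \<odot>\<^bsub>Z\<^esub> u \<oplus>\<^bsub>Z\<^esub> u = \<zero>\<^bsub>Z\<^esub>"
        using Zsub[OF u] by (simp add: Zadd Zsm Z0 neg neg')
    qed
  qed (use Zsub Zaddc Z0c in \<open>auto simp: Zadd Z0 X.M.a_ac P.M.a_ac\<close>)
  have Zmod: "left_module A Z"
    using Zab Zsub Zsmc
    by (auto simp: left_module_def left_module_axioms_def P.R.ring_axioms Zadd Zsm
        X.smult_l_distr P.smult_l_distr X.smult_r_distr P.smult_r_distr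
        X.smult_assoc P.smult_assoc)
  have single: "[(\<one>\<^bsub>A\<^esub>, p)] \<in> combs" "val1 [(\<one>\<^bsub>A\<^esub>, p)] = \<sigma> p" "val2 [(\<one>\<^bsub>A\<^esub>, p)] = p"
    if "p \<in> carrier P" for p
    using that by auto
  have sec: "(\<sigma> p, p) \<in> carrier Z" if "p \<in> carrier P" for p
    unfolding Zcar using single[OF that] by metis
  define eZ where "eZ = (\<lambda>u. {l \<in> combs. (val1 l, val2 l) = u})"
  define eP where "eP = (\<lambda>p. {l \<in> combs. val2 l = p})"
  define X' where "X' = transport eZ Z"
  define Y' where "Y' = transport eP P"
  define dZ where "dZ = inv_into (carrier Z) eZ"
  define dP where "dP = inv_into (carrier P) eP"
  have iZ: "inj_on eZ (carrier Z)"
    by (rule inj_onI) (auto simp: Zcar eZ_def)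
  have iP: "inj_on eP (carrier P)"
  proof (rule inj_onI)
    fix p q assume pq: "p \<in> carrier P" "q \<in> carrier P" "eP p = eP q"
    have "[(\<one>\<^bsub>A\<^esub>, p)] \<in> eP p" unfolding eP_def using single[OF pq(1)] by blast
    then have "[(\<one>\<^bsub>A\<^esub>, p)] \<in> eP q" using pq(3) by simp
    then have "val2 [(\<one>\<^bsub>A\<^esub>, p)] = q" unfolding eP_def by blast
    then show "p = q" using single(3)[OF pq(1)] by metis
  qed
  note tZ = transport_module[OF Zmod iZ, folded X'_def dZ_def]
  note tP = transport_module[OF P iP, folded Y'_def dP_def]
  note lin = linear_maps_def Pi_iff
  define f' where "f' = (\<lambda>u. eP (snd (dZ u)))"
  define \<tau> where "\<tau> = (\<lambda>u. fst (dZ u))"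
  have snd: "snd \<in> linear_maps A Z P" and fst: "fst \<in> linear_maps A Z X"
    using Zsub by (auto simp: lin Zadd Zsm)
  have f': "f' \<in> linear_maps A X' Y'"
    unfolding f'_def
    using linear_maps_comp[OF linear_maps_comp[OF tZ(3) snd] tP(2)] by simp
  have \<tau>: "\<tau> \<in> linear_maps A X' X"
    unfolding \<tau>_def using linear_maps_comp[OF tZ(3) fst] by simp
  have XZ: "carrier X' = eZ ` carrier Z" and YP: "carrier Y' = eP ` carrier P"
    by (auto simp: X'_def Y'_def transport_def Let_def)
  have f'Z: "f' (eZ u) = eP (snd u)" if "u \<in> carrier Z" for u
    using that by (simp add: f'_def tZ(4))
  have surj: "f' ` carrier X' = carrier Y'"
  proof
    show "f' ` carrier X' \<subseteq> carrier Y'" using f' by (auto simp: lin)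
    show "carrier Y' \<subseteq> f' ` carrier X'"
    proof
      fix y assume "y \<in> carrier Y'"
      then obtain p where p: "p \<in> carrier P" "y = eP p" by (auto simp: YP)
      then have "y = f' (eZ (\<sigma> p, p))" using f'Z[OF sec] by simp
      then show "y \<in> f' ` carrier X'" using sec p by (auto simp: XZ)
    qed
  qed
  have comm: "f (\<tau> z) = g (dP (f' z))"
    if z: "z \<in> carrier X'" for z
  proof -
    interpret W: left_module A W by fact
    have f0: "f \<zero>\<^bsub>X\<^esub> = \<zero>\<^bsub>W\<^esub>"
    proof -
      have "f \<zero>\<^bsub>X\<^esub> \<in> carrier W" using f by (auto simp: lin)
      moreover have "f (\<zero>\<^bsub>X\<^esub> \<oplus>\<^bsub>X\<^esub> \<zero>\<^bsub>X\<^esub>) = f \<zero>\<^bsub>X\<^esub> \<oplus>\<^bsub>W\<^esub> f \<zero>\<^bsub>X\<^esub>"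
        using f X.M.zero_closed unfolding linear_maps_def by blast
      ultimately show ?thesis by simp
    qed
    have g0: "g \<zero>\<^bsub>P\<^esub> = \<zero>\<^bsub>W\<^esub>"
    proof -
      have "g \<zero>\<^bsub>P\<^esub> \<in> carrier W" using g by (auto simp: lin)
      moreover have "g (\<zero>\<^bsub>P\<^esub> \<oplus>\<^bsub>P\<^esub> \<zero>\<^bsub>P\<^esub>) = g \<zero>\<^bsub>P\<^esub> \<oplus>\<^bsub>W\<^esub> g \<zero>\<^bsub>P\<^esub>"
        using g P.M.zero_closed unfolding linear_maps_def by blast
      ultimately show ?thesis by simp
    qed
    have eq: "f (val1 l) = g (val2 l)" if "l \<in> combs" for l
      using that
    proof (induction l)
      case (Cons x l)
      obtain a p where x: "x = (a, p)" by (cases x)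
      with Cons.prems have ap: "a \<in> carrier A" "p \<in> carrier P" "l \<in> combs" by auto
      then have "f (val1 (x # l)) = a \<odot>\<^bsub>W\<^esub> f (\<sigma> p) \<oplus>\<^bsub>W\<^esub> f (val1 l)"
        using f cl by (simp add: x linear_maps_def)
      moreover have "g (val2 (x # l)) = a \<odot>\<^bsub>W\<^esub> g p \<oplus>\<^bsub>W\<^esub> g (val2 l)"
        using g cl ap by (simp add: x linear_maps_def)
      ultimately show ?case
        using Cons.IH ap fg by simp
    qed (simp add: f0 g0)
    obtain l where l: "l \<in> combs" "z = eZ (val1 l, val2 l)"
      using z by (auto simp: XZ Zcar)
    have "(val1 l, val2 l) \<in> carrier Z" using l by (auto simp: Zcar)
    then show ?thesis
      using l eq by (simp add: \<tau>_def f'_def tZ(4) tP(4) cl)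
  qed
  have split: "R_split_epi R A X' Y' f'"
    if R: "assoc_algebra R A"
      and s: "\<sigma> \<in> linear_maps R (restrict_scalars R A P) (restrict_scalars R A X)" for R
  proof -
    have t: "(\<lambda>p. (\<sigma> p, p)) \<in> linear_maps R (restrict_scalars R A P) (restrict_scalars R A Z)"
      using s sec by (auto simp: lin restrict_scalars_def Zadd Zsm)
    have "(\<lambda>y. eZ (\<sigma> (dP y), dP y)) \<in>
        linear_maps R (restrict_scalars R A Y') (restrict_scalars R A X')"
      using linear_maps_comp[OF linear_maps_comp[OF linear_maps_restrict[OF R tP(3)] t]
          linear_maps_restrict[OF R tZ(2)]] by simp
    moreover have "f' (eZ (\<sigma> (dP y), dP y)) = y" if "y \<in> carrier Y'" for y
      using that f'Z sec by (auto simp: YP tP(4))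
    ultimately show ?thesis
      unfolding R_split_epi_def by (intro bexI[of _ "\<lambda>y. eZ (\<sigma> (dP y), dP y)"] ballI)
  qed
  show thesis
    by (rule that[of X' Y' f' eP \<tau> dP])
      (intro tZ(1) tP(1) f' surj tP(2) \<tau> ballI allI impI tP(4) comm split; (elim conjE)?, assumption)+
qed

end

theorem projective_lift:
  fixes A :: "('r, 'a) module" and P :: "('a, 'p) module"
  assumes "projective A P" and X: "left_module A X" and Y: "left_module A Y"
    and f: "f \<in> linear_maps A X Y" "f ` carrier X = carrier Y" and g: "g \<in> linear_maps A P Y"
  shows "\<exists>h\<in>linear_maps A P X. \<forall>p\<in>carrier P. f (h p) = g p"
proof -
  have P: "left_module A P" using assms(1) by (simp add: projective_def)
  define \<sigma> where "\<sigma> = (\<lambda>p. inv_into (carrier X) f (g p))"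
  have \<sigma>: "\<sigma> \<in> carrier P \<rightarrow> carrier X" "\<And>p. p \<in> carrier P \<Longrightarrow> f (\<sigma> p) = g p"
    using f g by (auto simp: \<sigma>_def linear_maps_def Pi_iff intro!: inv_into_into f_inv_into_f)
  obtain X' Y' :: "('a, ('a, 'p) test) module" and f' g' \<tau> \<delta> where *:
    "left_module A X'" "left_module A Y'" "f' \<in> linear_maps A X' Y'"
    "f' ` carrier X' = carrier Y'" "g' \<in> linear_maps A P Y'"
    "\<tau> \<in> linear_maps A X' X" "\<forall>p\<in>carrier P. \<delta> (g' p) = p"
    "\<forall>z\<in>carrier X'. f (\<tau> z) = g (\<delta> (f' z))"
    "\<forall>R. assoc_algebra R A \<and>
       \<sigma> \<in> linear_maps R (restrict_scalars R A P) (restrict_scalars R A X) \<longrightarrow>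
       R_split_epi R A X' Y' f'"
    by (rule lifting_data[OF P X Y \<sigma>(1) f(1) g \<sigma>(2)], assumption, rule that)
  obtain h where h: "h \<in> linear_maps A P X'" "\<And>p. p \<in> carrier P \<Longrightarrow> f' (h p) = g' p"
    using assms(1) *(1-5) unfolding projective_def by meson
  have "f (\<tau> (h p)) = g p" if "p \<in> carrier P" for p
    using h that *(7,8) by (auto simp: linear_maps_def Pi_iff)
  with linear_maps_comp[OF h(1) *(6)] show ?thesis
    by (intro bexI[of _ "\<lambda>p. \<tau> (h p)"] ballI)
qed

theorem rel_projective_lift:
  fixes A :: "('r, 'a) module" and P :: "('a, 'p) module"
  assumes R: "assoc_algebra R A" and "rel_projective R A P"
    and X: "left_module A X" and Y: "left_module A Y"
    and f: "f \<in> linear_maps A X Y" and split: "R_split_epi R A X Y f"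
    and g: "g \<in> linear_maps A P Y"
  shows "\<exists>h\<in>linear_maps A P X. \<forall>p\<in>carrier P. f (h p) = g p"
proof -
  have P: "left_module A P" using assms(2) by (simp add: rel_projective_def)
  obtain s where s: "s \<in> linear_maps R (restrict_scalars R A Y) (restrict_scalars R A X)"
    "\<And>y. y \<in> carrier Y \<Longrightarrow> f (s y) = y"
    using split by (auto simp: R_split_epi_def)
  define \<sigma> where "\<sigma> = (\<lambda>p. s (g p))"
  have \<sigma>R: "\<sigma> \<in> linear_maps R (restrict_scalars R A P) (restrict_scalars R A X)"
    unfolding \<sigma>_def by (rule linear_maps_comp[OF linear_maps_restrict[OF R g] s(1)])
  have \<sigma>: "\<sigma> \<in> carrier P \<rightarrow> carrier X" "\<And>p. p \<in> carrier P \<Longrightarrow> f (\<sigma> p) = g p"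
    using \<sigma>R s(2) g by (auto simp: linear_maps_def restrict_scalars_def \<sigma>_def)
  obtain X' Y' :: "('a, ('a, 'p) test) module" and f' g' \<tau> \<delta> where *:
    "left_module A X'" "left_module A Y'" "f' \<in> linear_maps A X' Y'"
    "f' ` carrier X' = carrier Y'" "g' \<in> linear_maps A P Y'"
    "\<tau> \<in> linear_maps A X' X" "\<forall>p\<in>carrier P. \<delta> (g' p) = p"
    "\<forall>z\<in>carrier X'. f (\<tau> z) = g (\<delta> (f' z))"
    "\<forall>R. assoc_algebra R A \<and>
       \<sigma> \<in> linear_maps R (restrict_scalars R A P) (restrict_scalars R A X) \<longrightarrow>
       R_split_epi R A X' Y' f'"
    by (rule lifting_data[OF P X Y \<sigma>(1) f g \<sigma>(2)], assumption, rule that)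
  obtain h where h: "h \<in> linear_maps A P X'" "\<And>p. p \<in> carrier P \<Longrightarrow> f' (h p) = g' p"
    using assms(2) *(1-5) *(9)[rule_format, OF conjI[OF R \<sigma>R]] unfolding rel_projective_def by meson
  have "f (\<tau> (h p)) = g p" if "p \<in> carrier P" for p
    using h that *(7,8) by (auto simp: linear_maps_def Pi_iff)
  with linear_maps_comp[OF h(1) *(6)] show ?thesis
    by (intro bexI[of _ "\<lambda>p. \<tau> (h p)"] ballI)
qed

section \<open>Resolutions\<close>

text \<open>The differential \<open>d k\<close> goes from \<open>P (Suc k)\<close> to \<open>P k\<close>, and \<open>e\<close> is the augmentation.\<close>

definition exact_augmented_complex ::
    "('r, 'a) module \<Rightarrow> ('a, 'm) module \<Rightarrow> (nat \<Rightarrow> ('a, 'p) module) \<Rightarrow>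
     (nat \<Rightarrow> 'p \<Rightarrow> 'p) \<Rightarrow> ('p \<Rightarrow> 'm) \<Rightarrow> bool" where
  "exact_augmented_complex A M P d e \<longleftrightarrow>
     left_module A M \<and> (\<forall>k. left_module A (P k)) \<and>
     e \<in> linear_maps A (P 0) M \<and> (\<forall>k. d k \<in> linear_maps A (P (Suc k)) (P k)) \<and>
     e ` carrier (P 0) = carrier M \<and>
     d 0 ` carrier (P 1) = {x \<in> carrier (P 0). e x = \<zero>\<^bsub>M\<^esub>} \<and>
     (\<forall>k. d (Suc k) ` carrier (P (Suc (Suc k))) =
          {x \<in> carrier (P (Suc k)). d k x = \<zero>\<^bsub>P k\<^esub>})"

text \<open>
  A complex with differential \<open>d\<close> is split if there are maps \<open>s\<close> of degree one with
  \<open>d \<circ> s \<circ> d = d\<close>; here this is applied to the augmented complex, regarded over \<open>R\<close>.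
\<close>

definition R_split_complex ::
    "'r ring \<Rightarrow> ('r, 'a) module \<Rightarrow> ('a, 'm) module \<Rightarrow> (nat \<Rightarrow> ('a, 'p) module) \<Rightarrow>
     (nat \<Rightarrow> 'p \<Rightarrow> 'p) \<Rightarrow> ('p \<Rightarrow> 'm) \<Rightarrow> bool" where
  "R_split_complex R A M P d e \<longleftrightarrow>
     (\<exists>t\<in>linear_maps R (restrict_scalars R A M) (restrict_scalars R A (P 0)).
        \<forall>x\<in>carrier (P 0). e (t (e x)) = e x) \<and>
     (\<exists>s. \<forall>k. s k \<in> linear_maps R (restrict_scalars R A (P k)) (restrict_scalars R A (P (Suc k)))
        \<and> (\<forall>x\<in>carrier (P (Suc k)). d k (s k (d k x)) = d k x))"

definition projective_resolution ::
    "('r, 'a) module \<Rightarrow> ('a, 'm) module \<Rightarrow> (nat \<Rightarrow> ('a, 'p) module) \<Rightarrow>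
     (nat \<Rightarrow> 'p \<Rightarrow> 'p) \<Rightarrow> ('p \<Rightarrow> 'm) \<Rightarrow> bool" where
  "projective_resolution A M P d e \<longleftrightarrow>
     exact_augmented_complex A M P d e \<and> (\<forall>k. projective A (P k))"

definition rel_projective_resolution ::
    "'r ring \<Rightarrow> ('r, 'a) module \<Rightarrow> ('a, 'm) module \<Rightarrow> (nat \<Rightarrow> ('a, 'p) module) \<Rightarrow>
     (nat \<Rightarrow> 'p \<Rightarrow> 'p) \<Rightarrow> ('p \<Rightarrow> 'm) \<Rightarrow> bool" where
  "rel_projective_resolution R A M P d e \<longleftrightarrow>
     exact_augmented_complex A M P d e \<and> (\<forall>k. rel_projective R A (P k)) \<and>
     R_split_complex R A M P d e"


section \<open>Tensor products and torsion groups\<close>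

definition tensor_relations ::
    "('r, 'a) module \<Rightarrow> ('a, 'n) module \<Rightarrow> ('a, 'm) module \<Rightarrow> (('n \<times> 'm) \<Rightarrow>\<^sub>0 int) set" where
  "tensor_relations A N M = generate (free_Abelian_group (carrier N \<times> carrier M))
     ({frag_of (x \<oplus>\<^bsub>N\<^esub> x', y) - frag_of (x, y) - frag_of (x', y) | x x' y.
         x \<in> carrier N \<and> x' \<in> carrier N \<and> y \<in> carrier M} \<union>
      {frag_of (x, y \<oplus>\<^bsub>M\<^esub> y') - frag_of (x, y) - frag_of (x, y') | x y y'.
         x \<in> carrier N \<and> y \<in> carrier M \<and> y' \<in> carrier M} \<union>
      {frag_of (a \<odot>\<^bsub>N\<^esub> x, y) - frag_of (x, a \<odot>\<^bsub>M\<^esub> y) | a x y.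
         a \<in> carrier A \<and> x \<in> carrier N \<and> y \<in> carrier M})"

text \<open>\<open>N \<otimes>\<^bsub>A\<^esub> M\<close> for a right module \<open>N\<close> and a left module \<open>M\<close>, an abelian group.\<close>

definition tensor_product ::
    "('r, 'a) module \<Rightarrow> ('a, 'n) module \<Rightarrow> ('a, 'm) module \<Rightarrow> (('n \<times> 'm) \<Rightarrow>\<^sub>0 int) set monoid" where
  "tensor_product A N M =
     free_Abelian_group (carrier N \<times> carrier M) Mod tensor_relations A N M"

text \<open>
  The map \<open>N \<otimes>\<^bsub>A\<^esub> M \<rightarrow> N \<otimes>\<^bsub>A\<^esub> M'\<close> induced by \<open>f : M \<rightarrow> M'\<close>: it sends the coset of \<open>x\<close> to the
  coset of the image of \<open>x\<close> under the map of free abelian groups induced by \<open>f\<close>.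
\<close>

definition tensor_map ::
    "('r, 'a) module \<Rightarrow> ('a, 'n) module \<Rightarrow> ('a, 'm') module \<Rightarrow> ('m \<Rightarrow> 'm') \<Rightarrow>
     (('n \<times> 'm) \<Rightarrow>\<^sub>0 int) set \<Rightarrow> (('n \<times> 'm') \<Rightarrow>\<^sub>0 int) set" where
  "tensor_map A N M' f X =
     (\<Union>x\<in>X. tensor_relations A N M' #>\<^bsub>free_Abelian_group (carrier N \<times> carrier M')\<^esub>
        frag_extend (\<lambda>(n, m). frag_of (n, f m)) x)"

definition cycles :: "(nat \<Rightarrow> 'c monoid) \<Rightarrow> (nat \<Rightarrow> 'c \<Rightarrow> 'c) \<Rightarrow> nat \<Rightarrow> 'c set" where
  "cycles C d k = (case k of 0 \<Rightarrow> carrier (C 0) | Suc j \<Rightarrow> kernel (C (Suc j)) (C j) (d j))"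

definition homology :: "(nat \<Rightarrow> 'c monoid) \<Rightarrow> (nat \<Rightarrow> 'c \<Rightarrow> 'c) \<Rightarrow> nat \<Rightarrow> 'c set monoid" where
  "homology C d k = (C k)\<lparr>carrier := cycles C d k\<rparr> Mod (d k ` carrier (C (Suc k)))"

text \<open>
  The group \<open>H\<^sub>k(N \<otimes>\<^bsub>A\<^esub> P)\<close>.  For a projective resolution \<open>P\<close> of \<open>M\<close> this is \<open>Tor\<^sub>k(N, M)\<close> over \<open>A\<close>,
  for an \<open>(A, R)\<close>-projective resolution it is the relative \<open>Tor\<^sub>k(N, M)\<close> over \<open>(A, R)\<close>;
  neither depends on the resolution up to isomorphism.
\<close>

definition Tor_of_resolution ::
    "('r, 'a) module \<Rightarrow> ('a, 'n) module \<Rightarrow> (nat \<Rightarrow> ('a, 'p) module) \<Rightarrow> (nat \<Rightarrow> 'p \<Rightarrow> 'p) \<Rightarrow> nat \<Rightarrow>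
     (('n \<times> 'p) \<Rightarrow>\<^sub>0 int) set set monoid" where
  "Tor_of_resolution A N P d k =
     homology (\<lambda>j. tensor_product A N (P j)) (\<lambda>j. tensor_map A N (P j) (d j)) k"

end

theory Submission
  imports Defs
begin

text \<open>
  The point is that a projective resolution \<open>Q\<close> of \<open>M\<close> is itself an \<open>(A, R)\<close>-projective
  resolution as soon as \<open>A\<close> and \<open>M\<close> are free over \<open>R\<close>; the proposition is then the independence of
  relative torsion groups of the choice of the \<open>(A, R)\<close>-projective resolution.

  Projective modules are trivially \<open>(A, R)\<close>-projective, so what has to be shown is that \<open>Q\<close> splits
  over \<open>R\<close>.  This is the usual argument that a bounded below exact complex of projectives is
  contractible: the augmentation has an \<open>R\<close>-linear section because \<open>M\<close> is free, and the contracting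
  homotopy is then built degree by degree, provided each \<open>Q\<^sub>k\<close> has the lifting property over \<open>R\<close>.
  This property comes from an adjunction.  Restriction of scalars is left adjoint to coinduction
  \<open>X \<mapsto> Hom\<^sub>R(A, X)\<close>, and coinduction preserves surjections because \<open>A\<close> is free over \<open>R\<close>; hence
  restriction preserves projectivity
  (\<open>projective_lift_over_base_ring\<close>, \<open>projective_resolution_R_split\<close>).

  Independence of the resolution is the comparison theorem of relative homological algebra: all
  lifting problems that occur are along differentials of \<open>R\<close>-split exact complexes, and these are
  what relative projectives can solve.  One gets chain maps in both directions over \<open>M\<close>
  (\<open>comparison_map\<close>) whose composites are homotopic to the identity
  (\<open>endomorphism_homotopic_to_identity\<close>).  Tensoring with a right module \<open>N\<close> is an additive functor
  (\<open>tensor_map_comp\<close>, \<open>tensor_map_add\<close>), so the tensored chain maps are mutually inverse on cycles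
  up to boundaries, and this suffices for an isomorphism of homology (\<open>homology_iso\<close>).
  The proposition is the case \<open>N = A/I\<close>.
\<close>

section \<open>Linear maps\<close>

lemma left_module_of_module: "module R M \<Longrightarrow> left_module R M"
  by (simp add: module_def module_axioms_def left_module_def left_module_axioms_def cring_def)

lemma linear_maps_closed:
  "f \<in> linear_maps K X Y \<Longrightarrow> x \<in> carrier X \<Longrightarrow> f x \<in> carrier Y"
  by (auto simp: linear_maps_def)

lemma linear_maps_add:
  "f \<in> linear_maps K X Y \<Longrightarrow> x \<in> carrier X \<Longrightarrow> y \<in> carrier X \<Longrightarrow> f (x \<oplus>\<^bsub>X\<^esub> y) = f x \<oplus>\<^bsub>Y\<^esub> f y"
  by (auto simp: linear_maps_def)

lemma linear_maps_smult:
  "f \<in> linear_maps K X Y \<Longrightarrow> a \<in> carrier K \<Longrightarrow> x \<in> carrier X \<Longrightarrow>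
   f (a \<odot>\<^bsub>X\<^esub> x) = a \<odot>\<^bsub>Y\<^esub> f x"
  by (auto simp: linear_maps_def)

lemma linear_maps_id: "(\<lambda>x. x) \<in> linear_maps K X X"
  by (auto simp: linear_maps_def)

context
  fixes K :: "('k, 'c) ring_scheme" and X :: "('k, 'x) module" and Y :: "('k, 'y) module"
  assumes X: "left_module K X" and Y: "left_module K Y"
begin

interpretation X: left_module K X by (rule X)
interpretation Y: left_module K Y by (rule Y)

lemma linear_maps_zero:
  assumes "f \<in> linear_maps K X Y" shows "f \<zero>\<^bsub>X\<^esub> = \<zero>\<^bsub>Y\<^esub>"
proof -
  have "f \<zero>\<^bsub>X\<^esub> \<oplus>\<^bsub>Y\<^esub> f \<zero>\<^bsub>X\<^esub> = f \<zero>\<^bsub>X\<^esub>"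
    using linear_maps_add[OF assms, of "\<zero>\<^bsub>X\<^esub>" "\<zero>\<^bsub>X\<^esub>"] by simp
  then show ?thesis
    using linear_maps_closed[OF assms X.M.zero_closed] by simp
qed

lemma linear_maps_a_inv:
  assumes f: "f \<in> linear_maps K X Y" and x: "x \<in> carrier X"
  shows "f (\<ominus>\<^bsub>X\<^esub> x) = \<ominus>\<^bsub>Y\<^esub> f x"
proof -
  have "f (\<ominus>\<^bsub>X\<^esub> x) \<oplus>\<^bsub>Y\<^esub> f x = \<zero>\<^bsub>Y\<^esub>"
    using linear_maps_add[OF f, of "\<ominus>\<^bsub>X\<^esub> x" x] linear_maps_zero[OF f] x by (simp add: X.M.l_neg)
  then show ?thesis
    using Y.M.minus_equality linear_maps_closed[OF f] x by (metis X.M.a_inv_closed)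
qed

lemma linear_maps_diff:
  assumes f: "f \<in> linear_maps K X Y" and "x \<in> carrier X" "y \<in> carrier X"
  shows "f (x \<ominus>\<^bsub>X\<^esub> y) = f x \<ominus>\<^bsub>Y\<^esub> f y"
  using assms by (simp add: a_minus_def linear_maps_add[OF f] linear_maps_a_inv)

lemma linear_maps_sum_of_maps:
  assumes f: "f \<in> linear_maps K X Y" and g: "g \<in> linear_maps K X Y"
  shows "(\<lambda>x. f x \<oplus>\<^bsub>Y\<^esub> g x) \<in> linear_maps K X Y"
  using assms unfolding linear_maps_def
  by (auto simp: Pi_iff Y.smult_r_distr Y.M.a_ac)

lemma linear_maps_zero_map: "(\<lambda>x. \<zero>\<^bsub>Y\<^esub>) \<in> linear_maps K X Y"
proof -
  have "a \<odot>\<^bsub>Y\<^esub> \<zero>\<^bsub>Y\<^esub> = \<zero>\<^bsub>Y\<^esub>" if "a \<in> carrier K" for a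
  proof -
    have "a \<odot>\<^bsub>Y\<^esub> \<zero>\<^bsub>Y\<^esub> \<oplus>\<^bsub>Y\<^esub> a \<odot>\<^bsub>Y\<^esub> \<zero>\<^bsub>Y\<^esub> = a \<odot>\<^bsub>Y\<^esub> \<zero>\<^bsub>Y\<^esub>"
      using that Y.smult_r_distr[of a "\<zero>\<^bsub>Y\<^esub>" "\<zero>\<^bsub>Y\<^esub>"] by simp
    then show ?thesis using that by simp
  qed
  then show ?thesis by (auto simp: linear_maps_def)
qed

lemma linear_maps_uminus:
  assumes f: "f \<in> linear_maps K X Y"
  shows "(\<lambda>x. \<ominus>\<^bsub>Y\<^esub> f x) \<in> linear_maps K X Y"
proof -
  have "\<ominus>\<^bsub>Y\<^esub> (a \<odot>\<^bsub>Y\<^esub> y) = a \<odot>\<^bsub>Y\<^esub> \<ominus>\<^bsub>Y\<^esub> y" if "a \<in> carrier K" "y \<in> carrier Y" for a y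
  proof -
    have "(a \<odot>\<^bsub>Y\<^esub> \<ominus>\<^bsub>Y\<^esub> y) \<oplus>\<^bsub>Y\<^esub> a \<odot>\<^bsub>Y\<^esub> y = a \<odot>\<^bsub>Y\<^esub> \<zero>\<^bsub>Y\<^esub>"
      using that Y.smult_r_distr[of a "\<ominus>\<^bsub>Y\<^esub> y" y] by (simp add: Y.M.l_neg)
    also have "\<dots> = \<zero>\<^bsub>Y\<^esub>"
      using linear_maps_zero_map linear_maps_smult[OF linear_maps_zero_map that(1) X.M.zero_closed]
      by simp
    finally show ?thesis using that by (intro Y.M.minus_equality) auto
  qed
  then show ?thesis
    using f by (auto simp: linear_maps_def Pi_iff Y.M.minus_add)
qed

lemma linear_maps_diff_of_maps:
  assumes f: "f \<in> linear_maps K X Y" and g: "g \<in> linear_maps K X Y"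
  shows "(\<lambda>x. f x \<ominus>\<^bsub>Y\<^esub> g x) \<in> linear_maps K X Y"
  unfolding a_minus_def
  by (intro linear_maps_sum_of_maps f linear_maps_uminus g)

lemma linear_maps_finsum:
  assumes f: "f \<in> linear_maps K X Y" and "finite S" and "v \<in> S \<rightarrow> carrier X"
  shows "f (finsum X v S) = (\<Oplus>\<^bsub>Y\<^esub>i\<in>S. f (v i))"
  using assms(2,3)
proof (induction S rule: finite_induct)
  case empty
  show ?case by (simp add: linear_maps_zero[OF f])
next
  case (insert i S)
  then have "v \<in> S \<rightarrow> carrier X" "v i \<in> carrier X" by auto
  moreover from this have "(\<lambda>i. f (v i)) \<in> S \<rightarrow> carrier Y"
    using linear_maps_closed[OF f] by auto
  ultimately show ?case
    using insert linear_maps_closed[OF f] by (simp add: linear_maps_add[OF f])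
qed

text \<open>
  The lifting properties of projective modules ask for surjections.  Passing to the image submodule
  turns them into the form used throughout below, where only \<open>g ` P \<subseteq> f ` X\<close> is required.
\<close>

lemma image_left_module:
  assumes f: "f \<in> linear_maps K X Y"
  shows "left_module K (Y\<lparr>carrier := f ` carrier X\<rparr>)"
proof -
  have "abelian_group (Y\<lparr>carrier := f ` carrier X\<rparr>)"
  proof (rule abelian_groupI)
    fix y assume "y \<in> carrier (Y\<lparr>carrier := f ` carrier X\<rparr>)"
    then obtain x where x: "x \<in> carrier X" "y = f x" by auto
    then have "f (\<ominus>\<^bsub>X\<^esub> x) \<oplus>\<^bsub>Y\<^esub> y = \<zero>\<^bsub>Y\<^esub>"
      using linear_maps_closed[OF f] by (simp add: linear_maps_a_inv[OF f] Y.M.l_neg)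
    then show "\<exists>z\<in>carrier (Y\<lparr>carrier := f ` carrier X\<rparr>).
        z \<oplus>\<^bsub>Y\<lparr>carrier := f ` carrier X\<rparr>\<^esub> y = \<zero>\<^bsub>Y\<lparr>carrier := f ` carrier X\<rparr>\<^esub>"
      using x by auto
  next
    fix y z assume "y \<in> carrier (Y\<lparr>carrier := f ` carrier X\<rparr>)" "z \<in> carrier (Y\<lparr>carrier := f ` carrier X\<rparr>)"
    then show "y \<oplus>\<^bsub>Y\<lparr>carrier := f ` carrier X\<rparr>\<^esub> z \<in> carrier (Y\<lparr>carrier := f ` carrier X\<rparr>)"
      by (auto simp: linear_maps_add[OF f, symmetric])
  next
    show "\<zero>\<^bsub>Y\<lparr>carrier := f ` carrier X\<rparr>\<^esub> \<in> carrier (Y\<lparr>carrier := f ` carrier X\<rparr>)"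
      using linear_maps_zero[OF f] by (auto intro: rev_image_eqI[OF X.M.zero_closed])
  qed (use linear_maps_closed[OF f] in \<open>auto simp: Y.M.a_ac\<close>)
  then show ?thesis
    using linear_maps_closed[OF f]
    by (auto simp: left_module_def left_module_axioms_def X.R.ring_axioms Y.smult_l_distr
        Y.smult_r_distr Y.smult_assoc linear_maps_smult[OF f, symmetric]
        X.smult_l_distr X.smult_assoc linear_maps_add[OF f])
qed

end

section \<open>Lifting maps out of free modules\<close>

text \<open>
  The coefficient functions over which \<^const>\<open>is_basis\<close> quantifies.
\<close>

definition finite_coeffs :: "('r, 'c) ring_scheme \<Rightarrow> 'b set \<Rightarrow> ('b \<Rightarrow> 'r) set" where
  "finite_coeffs R B = {c. (\<forall>b\<in>B. c b \<in> carrier R) \<and> (\<forall>b. b \<notin> B \<longrightarrow> c b = \<zero>\<^bsub>R\<^esub>) \<and>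
     finite {b. c b \<noteq> \<zero>\<^bsub>R\<^esub>}}"

definition combination ::
    "('r, 'c) ring_scheme \<Rightarrow> ('r, 'x) module \<Rightarrow> ('b \<Rightarrow> 'x) \<Rightarrow> ('b \<Rightarrow> 'r) \<Rightarrow> 'x" where
  "combination R X v c = (\<Oplus>\<^bsub>X\<^esub>b\<in>{b. c b \<noteq> \<zero>\<^bsub>R\<^esub>}. c b \<odot>\<^bsub>X\<^esub> v b)"

lemma is_basis_alt:
  "is_basis R M B \<longleftrightarrow>
     B \<subseteq> carrier M \<and> (\<forall>x\<in>carrier M. \<exists>!c. c \<in> finite_coeffs R B \<and> x = combination R M (\<lambda>b. b) c)"
  by (simp add: is_basis_def finite_coeffs_def combination_def)

lemma coeffs_support: "c \<in> finite_coeffs R B \<Longrightarrow> {b. c b \<noteq> \<zero>\<^bsub>R\<^esub>} \<subseteq> B"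
  by (auto simp: finite_coeffs_def)

lemma coeffs_closed: "c \<in> finite_coeffs R B \<Longrightarrow> b \<in> B \<Longrightarrow> c b \<in> carrier R"
  by (auto simp: finite_coeffs_def)

context
  fixes R :: "('r, 'c) ring_scheme" and B :: "'b set" and X :: "('r, 'x) module" and v :: "'b \<Rightarrow> 'x"
  assumes X: "left_module R X" and v: "v \<in> B \<rightarrow> carrier X"
begin

interpretation X: left_module R X by (rule X)

text \<open>
  The sum over the support of \<open>c\<close> may be taken over any larger finite set, so that the sums for
  different coefficient functions can be compared over a common index set.
\<close>

lemma combination_superset:
  assumes c: "c \<in> finite_coeffs R B" and S: "finite S" "{b. c b \<noteq> \<zero>\<^bsub>R\<^esub>} \<subseteq> S" "S \<subseteq> B"
  shows "combination R X v c = (\<Oplus>\<^bsub>X\<^esub>b\<in>S. c b \<odot>\<^bsub>X\<^esub> v b)"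
  unfolding combination_def
proof (rule X.M.add.finprod_mono_neutral_cong_left[OF S(1,2)])
  have z: "\<zero>\<^bsub>R\<^esub> \<odot>\<^bsub>X\<^esub> x = \<zero>\<^bsub>X\<^esub>" if "x \<in> carrier X" for x
    using that X.smult_l_distr[of "\<zero>\<^bsub>R\<^esub>" "\<zero>\<^bsub>R\<^esub>" x] by simp
  show "c i \<odot>\<^bsub>X\<^esub> v i = \<zero>\<^bsub>X\<^esub>" if "i \<in> S - {b. c b \<noteq> \<zero>\<^bsub>R\<^esub>}" for i
    using that v S(3) by (auto intro!: z)
  show "(\<lambda>b. c b \<odot>\<^bsub>X\<^esub> v b) \<in> S \<rightarrow> carrier X"
    using c v S(3) by (auto simp: finite_coeffs_def)
qed simp

lemma combination_closed:
  assumes "c \<in> finite_coeffs R B" shows "combination R X v c \<in> carrier X"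
  unfolding combination_def
  by (rule X.M.finsum_closed) (use assms v coeffs_support[OF assms] coeffs_closed[OF assms] in auto)

lemma combination_add:
  assumes c: "c \<in> finite_coeffs R B" and d: "d \<in> finite_coeffs R B"
  shows "(\<lambda>b. c b \<oplus>\<^bsub>R\<^esub> d b) \<in> finite_coeffs R B"
    and "combination R X v (\<lambda>b. c b \<oplus>\<^bsub>R\<^esub> d b) = combination R X v c \<oplus>\<^bsub>X\<^esub> combination R X v d"
proof -
  let ?S = "{b. c b \<noteq> \<zero>\<^bsub>R\<^esub>} \<union> {b. d b \<noteq> \<zero>\<^bsub>R\<^esub>}"
  have fin: "finite ?S" using c d by (simp add: finite_coeffs_def)
  have sub: "?S \<subseteq> B" using coeffs_support c d by blast
  have sup: "{b. c b \<oplus>\<^bsub>R\<^esub> d b \<noteq> \<zero>\<^bsub>R\<^esub>} \<subseteq> ?S" by auto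
  show cd: "(\<lambda>b. c b \<oplus>\<^bsub>R\<^esub> d b) \<in> finite_coeffs R B"
    using c d finite_subset[OF sup fin] by (auto simp: finite_coeffs_def)
  have cl: "c b \<in> carrier R" "d b \<in> carrier R" "v b \<in> carrier X" if "b \<in> ?S" for b
    using c d that sub v by (auto simp: finite_coeffs_def)
  have "(\<Oplus>\<^bsub>X\<^esub>b\<in>?S. (c b \<oplus>\<^bsub>R\<^esub> d b) \<odot>\<^bsub>X\<^esub> v b) = (\<Oplus>\<^bsub>X\<^esub>b\<in>?S. c b \<odot>\<^bsub>X\<^esub> v b \<oplus>\<^bsub>X\<^esub> d b \<odot>\<^bsub>X\<^esub> v b)"
    by (rule X.M.finsum_cong') (use cl in \<open>auto simp: X.smult_l_distr\<close>)
  also have "\<dots> = (\<Oplus>\<^bsub>X\<^esub>b\<in>?S. c b \<odot>\<^bsub>X\<^esub> v b) \<oplus>\<^bsub>X\<^esub> (\<Oplus>\<^bsub>X\<^esub>b\<in>?S. d b \<odot>\<^bsub>X\<^esub> v b)"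
    by (rule X.M.finsum_addf) (use cl in auto)
  finally show "combination R X v (\<lambda>b. c b \<oplus>\<^bsub>R\<^esub> d b) =
      combination R X v c \<oplus>\<^bsub>X\<^esub> combination R X v d"
    using combination_superset[OF cd fin sup sub] combination_superset[OF c fin _ sub]
      combination_superset[OF d fin _ sub] by simp
qed

lemma combination_linear_image:
  assumes Y: "left_module R Y" and f: "f \<in> linear_maps R X Y" and c: "c \<in> finite_coeffs R B"
  shows "f (combination R X v c) = combination R Y (\<lambda>b. f (v b)) c"
proof -
  interpret Y: left_module R Y by (rule Y)
  have cl: "c b \<in> carrier R" "v b \<in> carrier X" if "c b \<noteq> \<zero>\<^bsub>R\<^esub>" for b
    using c v coeffs_support[OF c] coeffs_closed[OF c] that by blast+
  have "f (combination R X v c) = (\<Oplus>\<^bsub>Y\<^esub>b\<in>{b. c b \<noteq> \<zero>\<^bsub>R\<^esub>}. f (c b \<odot>\<^bsub>X\<^esub> v b))"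
    unfolding combination_def
    by (rule linear_maps_finsum[OF X Y f]) (use c cl in \<open>auto simp: finite_coeffs_def\<close>)
  also have "\<dots> = combination R Y (\<lambda>b. f (v b)) c"
    unfolding combination_def
    by (rule Y.M.finsum_cong') (use cl linear_maps_smult[OF f] linear_maps_closed[OF f] in auto)
  finally show ?thesis .
qed

end

lemma combination_smult:
  assumes R: "cring R" and X: "left_module R X" and v: "v \<in> B \<rightarrow> carrier X"
    and r: "r \<in> carrier R" and c: "c \<in> finite_coeffs R B"
  shows "(\<lambda>b. r \<otimes>\<^bsub>R\<^esub> c b) \<in> finite_coeffs R B"
    and "combination R X v (\<lambda>b. r \<otimes>\<^bsub>R\<^esub> c b) = r \<odot>\<^bsub>X\<^esub> combination R X v c"
proof -
  interpret R: cring R by (rule R)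
  interpret X: left_module R X by (rule X)
  let ?S = "{b. c b \<noteq> \<zero>\<^bsub>R\<^esub>}"
  have fin: "finite ?S" using c by (simp add: finite_coeffs_def)
  have sub: "?S \<subseteq> B" using coeffs_support[OF c] .
  have sup: "{b. r \<otimes>\<^bsub>R\<^esub> c b \<noteq> \<zero>\<^bsub>R\<^esub>} \<subseteq> ?S" using r by auto
  show rc: "(\<lambda>b. r \<otimes>\<^bsub>R\<^esub> c b) \<in> finite_coeffs R B"
    using c r finite_subset[OF sup fin] by (auto simp: finite_coeffs_def)
  have cl: "c b \<in> carrier R" "v b \<in> carrier X" if "b \<in> ?S" for b
    using c that sub v by (auto simp: finite_coeffs_def)
  have lin: "(\<lambda>x. r \<odot>\<^bsub>X\<^esub> x) \<in> linear_maps R X X"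
  proof -
    have "r \<odot>\<^bsub>X\<^esub> (s \<odot>\<^bsub>X\<^esub> x) = s \<odot>\<^bsub>X\<^esub> (r \<odot>\<^bsub>X\<^esub> x)" if "s \<in> carrier R" "x \<in> carrier X" for s x
      using r that X.smult_assoc by (metis R.m_comm)
    then show ?thesis using r by (auto simp: linear_maps_def X.smult_r_distr)
  qed
  have "combination R X v (\<lambda>b. r \<otimes>\<^bsub>R\<^esub> c b) = (\<Oplus>\<^bsub>X\<^esub>b\<in>?S. (r \<otimes>\<^bsub>R\<^esub> c b) \<odot>\<^bsub>X\<^esub> v b)"
    by (rule combination_superset[OF X v rc fin sup sub])
  also have "\<dots> = (\<Oplus>\<^bsub>X\<^esub>b\<in>?S. r \<odot>\<^bsub>X\<^esub> (c b \<odot>\<^bsub>X\<^esub> v b))"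
    by (rule X.M.finsum_cong') (use cl r in \<open>auto simp: X.smult_assoc\<close>)
  also have "\<dots> = r \<odot>\<^bsub>X\<^esub> combination R X v c"
    unfolding combination_def
    by (rule linear_maps_finsum[OF X X lin fin, symmetric]) (use cl in auto)
  finally show "combination R X v (\<lambda>b. r \<otimes>\<^bsub>R\<^esub> c b) = r \<odot>\<^bsub>X\<^esub> combination R X v c" .
qed

text \<open>
  The values of \<open>h\<close> on a basis are chosen as preimages under \<open>f\<close> of those of \<open>g\<close>.  Linearity of the
  extension comes from uniqueness of coefficients: the coefficients of \<open>x \<oplus> y\<close> and of \<open>r \<odot> x\<close> must
  be the sums and multiples of the given ones.
\<close>

lemma free_module_lift:
  fixes R :: "'r ring"
  assumes R: "cring R" and F: "left_module R F" and free: "free_module R F"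
    and X: "left_module R X" and Y: "left_module R Y"
    and f: "f \<in> linear_maps R X Y" and g: "g \<in> linear_maps R F Y"
    and im: "g ` carrier F \<subseteq> f ` carrier X"
  shows "\<exists>h\<in>linear_maps R F X. \<forall>x\<in>carrier F. f (h x) = g x"
proof -
  interpret R: cring R by (rule R)
  interpret F: left_module R F by (rule F)
  obtain B where "is_basis R F B"
    using free unfolding free_module_def by (rule exE)
  then have B: "B \<subseteq> carrier F"
    and "\<forall>x\<in>carrier F. \<exists>!c. c \<in> finite_coeffs R B \<and> x = combination R F (\<lambda>b. b) c"
    unfolding is_basis_alt by simp_all
  then have ex1: "\<exists>!c. c \<in> finite_coeffs R B \<and> x = combination R F (\<lambda>b. b) c"
    if "x \<in> carrier F" for x
    using that by simp
  have idB: "(\<lambda>b. b) \<in> B \<rightarrow> carrier F" using B by auto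
  define v where "v = (\<lambda>b. inv_into (carrier X) f (g b))"
  have v: "v b \<in> carrier X" "f (v b) = g b" if "b \<in> B" for b
    using im B that by (auto simp: v_def intro!: inv_into_into f_inv_into_f)
  then have v: "v \<in> B \<rightarrow> carrier X" "\<And>b. b \<in> B \<Longrightarrow> f (v b) = g b"
    by auto
  define c where
    "c = (\<lambda>x. THE c. c \<in> finite_coeffs R B \<and> x = combination R F (\<lambda>b. b) c)"
  have c: "c x \<in> finite_coeffs R B" "combination R F (\<lambda>b. b) (c x) = x" if "x \<in> carrier F" for x
    using theI'[OF ex1[OF that]] by (auto simp: c_def)
  have c_eq: "c (combination R F (\<lambda>b. b) k) = k" if "k \<in> finite_coeffs R B" for k
    unfolding c_def
    by (rule the1_equality[OF ex1[OF combination_closed[OF F idB that]]]) (simp add: that)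
  define h where "h = (\<lambda>x. combination R X v (c x))"
  have "h \<in> linear_maps R F X"
    unfolding linear_maps_def
  proof (intro CollectI conjI ballI)
    show "h \<in> carrier F \<rightarrow> carrier X"
      using combination_closed[OF X v(1)] c by (simp add: h_def)
  next
    fix x y assume x: "x \<in> carrier F" and y: "y \<in> carrier F"
    have "c (x \<oplus>\<^bsub>F\<^esub> y) = (\<lambda>b. c x b \<oplus>\<^bsub>R\<^esub> c y b)"
      using c_eq[OF combination_add(1)[OF F idB c(1)[OF x] c(1)[OF y]]]
      by (simp add: combination_add(2)[OF F idB c(1)[OF x] c(1)[OF y]] c x y)
    then show "h (x \<oplus>\<^bsub>F\<^esub> y) = h x \<oplus>\<^bsub>X\<^esub> h y"
      using combination_add(2)[OF X v(1) c(1)[OF x] c(1)[OF y]] by (simp add: h_def)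
  next
    fix r x assume r: "r \<in> carrier R" and x: "x \<in> carrier F"
    have "c (r \<odot>\<^bsub>F\<^esub> x) = (\<lambda>b. r \<otimes>\<^bsub>R\<^esub> c x b)"
      using c_eq[OF combination_smult(1)[OF R F idB r c(1)[OF x]]]
      by (simp add: combination_smult(2)[OF R F idB r c(1)[OF x]] c x)
    then show "h (r \<odot>\<^bsub>F\<^esub> x) = r \<odot>\<^bsub>X\<^esub> h x"
      using combination_smult(2)[OF R X v(1) r c(1)[OF x]] by (simp add: h_def)
  qed
  moreover have "f (h x) = g x" if x: "x \<in> carrier F" for x
  proof -
    interpret Y: left_module R Y by (rule Y)
    have cl: "b \<in> B" "c x b \<in> carrier R" "g b \<in> carrier Y" if "c x b \<noteq> \<zero>\<^bsub>R\<^esub>" for b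
      using that coeffs_support[OF c(1)[OF x]] coeffs_closed[OF c(1)[OF x]] B
        linear_maps_closed[OF g] by blast+
    have "f (h x) = combination R Y (\<lambda>b. f (v b)) (c x)"
      unfolding h_def by (rule combination_linear_image[OF X v(1) Y f c(1)[OF x]])
    also have "\<dots> = combination R Y g (c x)"
      unfolding combination_def
      by (rule Y.M.finsum_cong') (use v(2) cl in auto)
    also have "\<dots> = g (combination R F (\<lambda>b. b) (c x))"
      by (rule combination_linear_image[OF F idB Y g c(1)[OF x], symmetric])
    finally show ?thesis using c(2)[OF x] by simp
  qed
  ultimately show ?thesis by blast
qed

section \<open>Projective modules over an algebra that is free over its base ring\<close>

text \<open>
  \<open>Hom\<^sub>R(A, X)\<close>, on which \<open>a \<in> A\<close> acts by precomposition with right multiplication by \<open>a\<close>; this makes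
  it a left \<open>A\<close>-module.  Linear maps are restricted to the carrier of \<open>A\<close> so that equal maps are
  equal as functions.
\<close>

definition coinduced_module ::
    "'r ring \<Rightarrow> ('r, 'a) module \<Rightarrow> ('r, 'x) module \<Rightarrow> ('a, 'a \<Rightarrow> 'x) module" where
  "coinduced_module R A X =
     \<lparr>carrier = linear_maps R A X \<inter> extensional (carrier A), mult = undefined, one = undefined,
      zero = (\<lambda>b\<in>carrier A. \<zero>\<^bsub>X\<^esub>), add = (\<lambda>\<phi> \<psi>. \<lambda>b\<in>carrier A. \<phi> b \<oplus>\<^bsub>X\<^esub> \<psi> b),
      smult = (\<lambda>a \<phi>. \<lambda>b\<in>carrier A. \<phi> (b \<otimes>\<^bsub>A\<^esub> a))\<rparr>"

lemma assoc_algebra_left_module: "assoc_algebra R A \<Longrightarrow> left_module R A"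
  by (simp add: assoc_algebra_def left_module_of_module)

lemma restrict_linear_maps:
  assumes A: "left_module R A" and f: "f \<in> linear_maps R A X"
  shows "restrict f (carrier A) \<in> linear_maps R A X \<inter> extensional (carrier A)"
proof -
  interpret A: left_module R A by (rule A)
  show ?thesis using f by (auto simp: linear_maps_def)
qed

lemma right_mult_linear:
  assumes A: "assoc_algebra R A" and a: "a \<in> carrier A"
  shows "(\<lambda>b. b \<otimes>\<^bsub>A\<^esub> a) \<in> linear_maps R A A"
proof -
  interpret A: ring A using A by (simp add: assoc_algebra_def)
  show ?thesis
    using A a by (auto simp: linear_maps_def assoc_algebra_def A.l_distr)
qed

lemma coinduced_left_module:
  assumes A: "assoc_algebra R A" and X: "left_module R X"
  shows "left_module A (coinduced_module R A X)"
proof -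
  have AM: "left_module R A" by (rule assoc_algebra_left_module[OF A])
  interpret A: ring A using A by (simp add: assoc_algebra_def)
  interpret X: left_module R X by (rule X)
  note cl = linear_maps_closed and res = restrict_linear_maps[OF AM]
  have "abelian_group (coinduced_module R A X)"
  proof (rule abelian_groupI)
    fix \<phi> assume \<phi>: "\<phi> \<in> carrier (coinduced_module R A X)"
    then have "restrict (\<lambda>b. \<ominus>\<^bsub>X\<^esub> \<phi> b) (carrier A) \<in> carrier (coinduced_module R A X)"
      by (auto simp: coinduced_module_def intro!: res[simplified] linear_maps_uminus[OF AM X])
    moreover have "restrict (\<lambda>b. \<ominus>\<^bsub>X\<^esub> \<phi> b) (carrier A) \<oplus>\<^bsub>coinduced_module R A X\<^esub> \<phi> =
        \<zero>\<^bsub>coinduced_module R A X\<^esub>"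
      using \<phi> by (auto simp: coinduced_module_def X.M.l_neg cl intro!: restrict_ext)
    ultimately show "\<exists>\<psi>\<in>carrier (coinduced_module R A X).
        \<psi> \<oplus>\<^bsub>coinduced_module R A X\<^esub> \<phi> = \<zero>\<^bsub>coinduced_module R A X\<^esub>" by blast
  next
    fix \<phi> assume \<phi>: "\<phi> \<in> carrier (coinduced_module R A X)"
    then show "\<zero>\<^bsub>coinduced_module R A X\<^esub> \<oplus>\<^bsub>coinduced_module R A X\<^esub> \<phi> = \<phi>"
      by (auto simp: coinduced_module_def fun_eq_iff cl extensional_def)
  qed (auto simp: coinduced_module_def X.M.a_ac cl
      intro!: restrict_ext res[simplified] linear_maps_sum_of_maps[OF AM X] linear_maps_zero_map[OF AM X])
  moreover have "\<phi> (b \<otimes>\<^bsub>A\<^esub> (a \<oplus>\<^bsub>A\<^esub> a')) = \<phi> (b \<otimes>\<^bsub>A\<^esub> a) \<oplus>\<^bsub>X\<^esub> \<phi> (b \<otimes>\<^bsub>A\<^esub> a')"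
    if "\<phi> \<in> linear_maps R A X" "a \<in> carrier A" "a' \<in> carrier A" "b \<in> carrier A" for \<phi> a a' b
    using that by (simp add: A.r_distr linear_maps_add)
  moreover have "restrict (\<lambda>b. \<phi> (b \<otimes>\<^bsub>A\<^esub> a)) (carrier A) \<in> linear_maps R A X \<inter> extensional (carrier A)"
    if "\<phi> \<in> linear_maps R A X" "a \<in> carrier A" for \<phi> a
    using linear_maps_comp[OF right_mult_linear[OF A that(2)] that(1)] by (rule res)
  moreover have "restrict \<phi> (carrier A) = \<phi>" if "\<phi> \<in> extensional (carrier A)" for \<phi> :: "'b \<Rightarrow> 'c"
    using that by (rule extensional_restrict)
  ultimately show ?thesis
    by (auto simp: left_module_def left_module_axioms_def A.ring_axioms coinduced_module_def
        A.m_assoc cong: restrict_cong intro!: restrict_ext)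
qed

lemma projective_lift_onto_image:
  assumes P: "projective A P" and X: "left_module A X" and Y: "left_module A Y"
    and f: "f \<in> linear_maps A X Y" and g: "g \<in> linear_maps A P Y"
    and im: "g ` carrier P \<subseteq> f ` carrier X"
  shows "\<exists>h\<in>linear_maps A P X. \<forall>p\<in>carrier P. f (h p) = g p"
proof (rule projective_lift[OF P X image_left_module[OF X Y f]])
  show "f \<in> linear_maps A X (Y\<lparr>carrier := f ` carrier X\<rparr>)"
    using f by (auto simp: linear_maps_def)
  show "f ` carrier X = carrier (Y\<lparr>carrier := f ` carrier X\<rparr>)" by simp
  show "g \<in> linear_maps A P (Y\<lparr>carrier := f ` carrier X\<rparr>)"
    using g im by (auto simp: linear_maps_def)
qed

text \<open>
  The condition on \<open>s\<close> is the one satisfied by the splittings in \<^const>\<open>R_split_complex\<close>.  It says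
  that \<open>s\<close> is a section of \<open>f\<close> over the image of \<open>f\<close>, which replaces \<open>Y\<close> in the lifting property.
\<close>

lemma rel_projective_lift_onto_image:
  assumes R: "assoc_algebra R A" and P: "rel_projective R A P"
    and X: "left_module A X" and Y: "left_module A Y"
    and f: "f \<in> linear_maps A X Y"
    and s: "s \<in> linear_maps R (restrict_scalars R A Y) (restrict_scalars R A X)"
    and fsf: "\<And>x. x \<in> carrier X \<Longrightarrow> f (s (f x)) = f x"
    and g: "g \<in> linear_maps A P Y"
    and im: "g ` carrier P \<subseteq> f ` carrier X"
  shows "\<exists>h\<in>linear_maps A P X. \<forall>p\<in>carrier P. f (h p) = g p"
proof (rule rel_projective_lift[OF R P X image_left_module[OF X Y f]])
  show "f \<in> linear_maps A X (Y\<lparr>carrier := f ` carrier X\<rparr>)"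
    using f by (auto simp: linear_maps_def)
  show "g \<in> linear_maps A P (Y\<lparr>carrier := f ` carrier X\<rparr>)"
    using g im by (auto simp: linear_maps_def)
  show "R_split_epi R A X (Y\<lparr>carrier := f ` carrier X\<rparr>) f"
    unfolding R_split_epi_def
  proof (intro bexI[of _ s] ballI)
    show "s \<in> linear_maps R (restrict_scalars R A (Y\<lparr>carrier := f ` carrier X\<rparr>))
        (restrict_scalars R A X)"
      using s linear_maps_closed[OF f] by (auto simp: linear_maps_def restrict_scalars_def)
  qed (use fsf in auto)
qed

text \<open>
  By adjunction an \<open>R\<close>-linear map \<open>g : P \<rightarrow> Y\<close> is the same as the \<open>A\<close>-linear map
  \<open>P \<rightarrow> Hom\<^sub>R(A, Y)\<close> sending \<open>p\<close> to \<open>b \<mapsto> g (b p)\<close>.  As \<open>A\<close> is free over \<open>R\<close>, each of these values is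
  in the image of \<open>Hom\<^sub>R(A, X)\<close>, so the adjoint map lifts to an \<open>A\<close>-linear map \<open>H\<close>, and
  \<open>p \<mapsto> H p 1\<close> is the required lift of \<open>g\<close>.
\<close>

lemma projective_lift_over_base_ring:
  assumes cring: "cring R" and A: "assoc_algebra R A" and free: "free_module R A"
    and P: "projective A P" and X: "left_module R X" and Y: "left_module R Y"
    and f: "f \<in> linear_maps R X Y" and g: "g \<in> linear_maps R (restrict_scalars R A P) Y"
    and im: "g ` carrier P \<subseteq> f ` carrier X"
  shows "\<exists>h\<in>linear_maps R (restrict_scalars R A P) X. \<forall>p\<in>carrier P. f (h p) = g p"
proof -
  have PM: "left_module A P" using P by (simp add: projective_def)
  have AM: "left_module R A" by (rule assoc_algebra_left_module[OF A])
  interpret AM: left_module R A by (rule AM)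
  interpret A: ring A using A by (simp add: assoc_algebra_def)
  interpret P: left_module A P by (rule PM)
  let ?CX = "coinduced_module R A X" and ?CY = "coinduced_module R A Y"
  let ?f = "\<lambda>\<phi>. \<lambda>b\<in>carrier A. f (\<phi> b)"
  let ?g = "\<lambda>p. \<lambda>b\<in>carrier A. g (b \<odot>\<^bsub>P\<^esub> p)"
  note res = restrict_linear_maps[OF AM, simplified]
  have f': "?f \<in> linear_maps A ?CX ?CY"
    using f by (auto simp: linear_maps_def[of A] coinduced_module_def linear_maps_add[OF f]
        linear_maps_closed intro!: res linear_maps_comp[of _ R A X f Y])
  \<comment> \<open>Compares the two \<open>R\<close>-actions: through \<open>A\<close> as an \<open>R\<close>-module, and through restricted scalars.\<close>
  have scalar: "(r \<odot>\<^bsub>A\<^esub> a) \<odot>\<^bsub>P\<^esub> p = (r \<odot>\<^bsub>A\<^esub> \<one>\<^bsub>A\<^esub>) \<odot>\<^bsub>P\<^esub> (a \<odot>\<^bsub>P\<^esub> p)"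
    if "r \<in> carrier R" "a \<in> carrier A" "p \<in> carrier P" for r a p
  proof -
    have "(r \<odot>\<^bsub>A\<^esub> \<one>\<^bsub>A\<^esub>) \<otimes>\<^bsub>A\<^esub> a = r \<odot>\<^bsub>A\<^esub> a"
      using A that unfolding assoc_algebra_def by (metis A.l_one A.one_closed)
    then show ?thesis using that by (metis A.one_closed AM.smult_closed P.smult_assoc)
  qed
  have orbit: "(\<lambda>b. g (b \<odot>\<^bsub>P\<^esub> p)) \<in> linear_maps R A Y" if p: "p \<in> carrier P" for p
    by (rule linear_maps_comp[of "\<lambda>b. b \<odot>\<^bsub>P\<^esub> p" R A "restrict_scalars R A P", OF _ g])
      (use p in \<open>auto simp: linear_maps_def restrict_scalars_def P.smult_l_distr intro: scalar\<close>)
  have g': "?g \<in> linear_maps A P ?CY"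
    unfolding linear_maps_def[of A]
    by (auto simp: coinduced_module_def orbit intro!: res)
      (auto simp: P.smult_r_distr P.smult_assoc[symmetric] fun_eq_iff
        linear_maps_add[OF g, unfolded restrict_scalars_def, simplified])
  have "?g ` carrier P \<subseteq> ?f ` carrier ?CX"
  proof (rule image_subsetI)
    fix p assume p: "p \<in> carrier P"
    have "(\<lambda>b. g (b \<odot>\<^bsub>P\<^esub> p)) ` carrier A \<subseteq> f ` carrier X"
      using im p by auto
    then obtain h where h: "h \<in> linear_maps R A X" "\<And>b. b \<in> carrier A \<Longrightarrow> f (h b) = g (b \<odot>\<^bsub>P\<^esub> p)"
      using free_module_lift[OF cring AM free X Y f orbit[OF p]] by blast
    show "?g p \<in> ?f ` carrier ?CX"
    proof (rule image_eqI)
      show "restrict h (carrier A) \<in> carrier ?CX"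
        using res[OF h(1)] by (simp add: coinduced_module_def)
      show "?g p = ?f (restrict h (carrier A))"
        by (rule restrict_ext) (simp add: h(2))
    qed
  qed
  then obtain H where H: "H \<in> linear_maps A P ?CX" "\<And>p. p \<in> carrier P \<Longrightarrow> ?f (H p) = ?g p"
    using projective_lift_onto_image[OF P coinduced_left_module[OF A X] coinduced_left_module[OF A Y]
        f' g'] by blast
  have Hlin: "H p \<in> linear_maps R A X" if "p \<in> carrier P" for p
    using linear_maps_closed[OF H(1) that] by (simp add: coinduced_module_def)
  let ?h = "\<lambda>p. H p \<one>\<^bsub>A\<^esub>"
  have "?h \<in> linear_maps R (restrict_scalars R A P) X"
    unfolding linear_maps_def
  proof (intro CollectI conjI ballI)
    show "?h \<in> carrier (restrict_scalars R A P) \<rightarrow> carrier X"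
      using linear_maps_closed[OF Hlin A.one_closed] by (auto simp: restrict_scalars_def)
  next
    fix p q assume "p \<in> carrier (restrict_scalars R A P)" "q \<in> carrier (restrict_scalars R A P)"
    then show "?h (p \<oplus>\<^bsub>restrict_scalars R A P\<^esub> q) = ?h p \<oplus>\<^bsub>X\<^esub> ?h q"
      using linear_maps_add[OF H(1)] by (simp add: restrict_scalars_def coinduced_module_def)
  next
    fix r p assume r: "r \<in> carrier R" and "p \<in> carrier (restrict_scalars R A P)"
    then have p: "p \<in> carrier P" by (simp add: restrict_scalars_def)
    have "?h ((r \<odot>\<^bsub>A\<^esub> \<one>\<^bsub>A\<^esub>) \<odot>\<^bsub>P\<^esub> p) = H p (r \<odot>\<^bsub>A\<^esub> \<one>\<^bsub>A\<^esub>)"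
      using linear_maps_smult[OF H(1) _ p] r by (simp add: coinduced_module_def)
    also have "\<dots> = r \<odot>\<^bsub>X\<^esub> ?h p"
      by (rule linear_maps_smult[OF Hlin[OF p] r A.one_closed])
    finally show "?h (r \<odot>\<^bsub>restrict_scalars R A P\<^esub> p) = r \<odot>\<^bsub>X\<^esub> ?h p"
      by (simp add: restrict_scalars_def)
  qed
  moreover have "\<forall>p\<in>carrier P. f (?h p) = g p"
    using fun_cong[OF H(2), of _ "\<one>\<^bsub>A\<^esub>"] by simp
  ultimately show ?thesis by (intro bexI[of _ ?h])
qed

lemma projective_imp_rel_projective:
  assumes P: "projective A P" shows "rel_projective R A P"
  unfolding rel_projective_def
proof (intro conjI allI impI)
  show "left_module A P" using P by (simp add: projective_def)
qed (elim conjE, rule projective_lift[OF P])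

section \<open>Comparison of resolutions\<close>

lemma exact_augmented_complexD:
  assumes "exact_augmented_complex A M P d e"
  shows "left_module A M" "left_module A (P k)" "e \<in> linear_maps A (P 0) M"
    and "d k \<in> linear_maps A (P (Suc k)) (P k)" "e ` carrier (P 0) = carrier M"
    and "x \<in> carrier (P (Suc 0)) \<Longrightarrow> e (d 0 x) = \<zero>\<^bsub>M\<^esub>"
    and "y \<in> carrier (P (Suc (Suc k))) \<Longrightarrow> d k (d (Suc k) y) = \<zero>\<^bsub>P k\<^esub>"
    and "z \<in> carrier (P 0) \<Longrightarrow> e z = \<zero>\<^bsub>M\<^esub> \<Longrightarrow> z \<in> d 0 ` carrier (P (Suc 0))"
    and "w \<in> carrier (P (Suc k)) \<Longrightarrow> d k w = \<zero>\<^bsub>P k\<^esub> \<Longrightarrow>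
      w \<in> d (Suc k) ` carrier (P (Suc (Suc k)))"
proof -
  have im: "d 0 ` carrier (P (Suc 0)) = {x \<in> carrier (P 0). e x = \<zero>\<^bsub>M\<^esub>}"
    "d (Suc k) ` carrier (P (Suc (Suc k))) = {x \<in> carrier (P (Suc k)). d k x = \<zero>\<^bsub>P k\<^esub>}"
    using assms by (simp_all add: exact_augmented_complex_def)
  show "x \<in> carrier (P (Suc 0)) \<Longrightarrow> e (d 0 x) = \<zero>\<^bsub>M\<^esub>"
    "y \<in> carrier (P (Suc (Suc k))) \<Longrightarrow> d k (d (Suc k) y) = \<zero>\<^bsub>P k\<^esub>"
    using im by blast+
  show "z \<in> carrier (P 0) \<Longrightarrow> e z = \<zero>\<^bsub>M\<^esub> \<Longrightarrow> z \<in> d 0 ` carrier (P (Suc 0))"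
    "w \<in> carrier (P (Suc k)) \<Longrightarrow> d k w = \<zero>\<^bsub>P k\<^esub> \<Longrightarrow>
      w \<in> d (Suc k) ` carrier (P (Suc (Suc k)))"
    using im by simp_all
qed (use assms in \<open>simp_all add: exact_augmented_complex_def\<close>)

text \<open>
  A chain map \<open>u\<close> whose degree zero part consists of boundaries is null homotopic.  The lifting
  property of the terms is an assumption about \<open>P\<close> and \<open>Q\<close>, because the lemma is applied both over
  \<open>A\<close>, where it comes from relative projectivity, and over \<open>R\<close>, where it comes from freeness of \<open>A\<close>.
  In the recursion \<open>h\<^sub>k\<close> satisfies \<open>d h\<^sub>k d = u\<^sub>k d\<close>, which is exactly what makes
  \<open>u\<^sub>k\<^sub>+\<^sub>1 - h\<^sub>k d\<close> take values in cycles, hence in boundaries.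
\<close>

lemma null_homotopy:
  fixes P :: "nat \<Rightarrow> ('k, 'p) module" and Q :: "nat \<Rightarrow> ('k, 'q) module"
  assumes P: "\<And>k. left_module K (P k)" and Q: "\<And>k. left_module K (Q k)"
    and dP: "\<And>k. dP k \<in> linear_maps K (P (Suc k)) (P k)"
    and dQ: "\<And>k. dQ k \<in> linear_maps K (Q (Suc k)) (Q k)"
    and dP_dP: "\<And>k x. x \<in> carrier (P (Suc (Suc k))) \<Longrightarrow> dP k (dP (Suc k) x) = \<zero>\<^bsub>P k\<^esub>"
    and exact: "\<And>k y. y \<in> carrier (Q (Suc k)) \<Longrightarrow> dQ k y = \<zero>\<^bsub>Q k\<^esub> \<Longrightarrow>
      y \<in> dQ (Suc k) ` carrier (Q (Suc (Suc k)))"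
    and lift: "\<And>k g. g \<in> linear_maps K (P k) (Q k) \<Longrightarrow>
      g ` carrier (P k) \<subseteq> dQ k ` carrier (Q (Suc k)) \<Longrightarrow>
      \<exists>h\<in>linear_maps K (P k) (Q (Suc k)). \<forall>x\<in>carrier (P k). dQ k (h x) = g x"
    and u: "\<And>k. u k \<in> linear_maps K (P k) (Q k)"
    and u0: "u 0 ` carrier (P 0) \<subseteq> dQ 0 ` carrier (Q (Suc 0))"
    and chain: "\<And>k x. x \<in> carrier (P (Suc k)) \<Longrightarrow> dQ k (u (Suc k) x) = u k (dP k x)"
  obtains h where "\<And>k. h k \<in> linear_maps K (P k) (Q (Suc k))"
    and "\<And>x. x \<in> carrier (P 0) \<Longrightarrow> dQ 0 (h 0 x) = u 0 x"
    and "\<And>k x. x \<in> carrier (P (Suc k)) \<Longrightarrow>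
      dQ (Suc k) (h (Suc k) x) = u (Suc k) x \<ominus>\<^bsub>Q (Suc k)\<^esub> h k (dP k x)"
proof -
  have "\<exists>h. \<forall>k. (h k \<in> linear_maps K (P k) (Q (Suc k)) \<and>
        (\<forall>x\<in>carrier (P (Suc k)). dQ k (h k (dP k x)) = u k (dP k x)) \<and>
        (k = 0 \<longrightarrow> (\<forall>x\<in>carrier (P k). dQ k (h k x) = u k x))) \<and>
      (\<forall>x\<in>carrier (P (Suc k)).
        dQ (Suc k) (h (Suc k) x) = u (Suc k) x \<ominus>\<^bsub>Q (Suc k)\<^esub> h k (dP k x))"
    (is "\<exists>h. \<forall>k. ?I k (h k) \<and> ?S k (h k) (h (Suc k))")
  proof (rule dependent_nat_choice)
    obtain h where "h \<in> linear_maps K (P 0) (Q (Suc 0))" "\<And>x. x \<in> carrier (P 0) \<Longrightarrow> dQ 0 (h x) = u 0 x"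
      using lift[OF u u0] by blast
    then show "\<exists>h. ?I 0 h"
      using linear_maps_closed[OF dP] by (intro exI[of _ h]) auto
  next
    fix h k assume I: "?I k h"
    then have h: "h \<in> linear_maps K (P k) (Q (Suc k))"
      and dh: "\<And>x. x \<in> carrier (P (Suc k)) \<Longrightarrow> dQ k (h (dP k x)) = u k (dP k x)" by auto
    interpret Qk: left_module K "Q k" by (rule Q)
    interpret QS: left_module K "Q (Suc k)" by (rule Q)
    let ?g = "\<lambda>x. u (Suc k) x \<ominus>\<^bsub>Q (Suc k)\<^esub> h (dP k x)"
    have g: "?g \<in> linear_maps K (P (Suc k)) (Q (Suc k))"
      by (rule linear_maps_diff_of_maps[OF P Q u linear_maps_comp[OF dP h]])
    have "?g ` carrier (P (Suc k)) \<subseteq> dQ (Suc k) ` carrier (Q (Suc (Suc k)))"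
    proof (rule image_subsetI)
      fix x assume x: "x \<in> carrier (P (Suc k))"
      note cl = linear_maps_closed[OF u x] linear_maps_closed[OF h linear_maps_closed[OF dP x]]
      have "dQ k (?g x) = dQ k (u (Suc k) x) \<ominus>\<^bsub>Q k\<^esub> dQ k (h (dP k x))"
        by (rule linear_maps_diff[OF Q Q dQ cl])
      also have "\<dots> = \<zero>\<^bsub>Q k\<^esub>"
        using linear_maps_closed[OF u linear_maps_closed[OF dP x]]
        by (simp add: chain dh x a_minus_def Qk.M.r_neg)
      finally show "?g x \<in> dQ (Suc k) ` carrier (Q (Suc (Suc k)))"
        by (rule exact[OF linear_maps_closed[OF g x]])
    qed
    then obtain h' where h': "h' \<in> linear_maps K (P (Suc k)) (Q (Suc (Suc k)))"
        "\<And>x. x \<in> carrier (P (Suc k)) \<Longrightarrow> dQ (Suc k) (h' x) = ?g x"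
      using lift[OF g] by blast
    have "dQ (Suc k) (h' (dP (Suc k) x)) = u (Suc k) (dP (Suc k) x)"
      if x: "x \<in> carrier (P (Suc (Suc k)))" for x
      using linear_maps_closed[OF u linear_maps_closed[OF dP x]] linear_maps_zero[OF P Q h]
      by (simp add: h'(2)[OF linear_maps_closed[OF dP x]] dP_dP[OF x] a_minus_def)
    then show "\<exists>h'. ?I (Suc k) h' \<and> ?S k h h'"
      using h' by (intro exI[of _ h']) auto
  qed
  then show thesis using that by metis
qed

text \<open>
  The recursion carries along that \<open>f\<^sub>k\<close> maps boundaries to boundaries, which makes \<open>f\<^sub>k d\<close> liftable
  along the differential of \<open>Q\<close>.
\<close>

lemma comparison_map:
  fixes P :: "nat \<Rightarrow> ('a, 'p) module" and Q :: "nat \<Rightarrow> ('a, 'q) module"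
  assumes A: "assoc_algebra R A"
    and P: "exact_augmented_complex A M P dP eP" "\<And>k. rel_projective R A (P k)"
    and Q: "exact_augmented_complex A M Q dQ eQ" "R_split_complex R A M Q dQ eQ"
  obtains f where "\<And>k. f k \<in> linear_maps A (P k) (Q k)"
    and "\<And>x. x \<in> carrier (P 0) \<Longrightarrow> eQ (f 0 x) = eP x"
    and "\<And>k x. x \<in> carrier (P (Suc k)) \<Longrightarrow> dQ k (f (Suc k) x) = f k (dP k x)"
proof -
  note P_complex = exact_augmented_complexD[OF P(1)] and Q_complex = exact_augmented_complexD[OF Q(1)]
  note PM = P_complex(2) and dP = P_complex(4) and QM = Q_complex(2) and dQ = Q_complex(4)
  note M = P_complex(1) and eP = P_complex(3) and eQ = Q_complex(3) and onto = Q_complex(5)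
  obtain t where t: "t \<in> linear_maps R (restrict_scalars R A M) (restrict_scalars R A (Q 0))"
    "\<And>x. x \<in> carrier (Q 0) \<Longrightarrow> eQ (t (eQ x)) = eQ x"
    using Q(2) by (auto simp: R_split_complex_def)
  obtain s where s: "\<And>k. s k \<in> linear_maps R (restrict_scalars R A (Q k)) (restrict_scalars R A (Q (Suc k)))"
    "\<And>k x. x \<in> carrier (Q (Suc k)) \<Longrightarrow> dQ k (s k (dQ k x)) = dQ k x"
    using Q(2) by (auto simp: R_split_complex_def)
  have "\<exists>f. \<forall>k. (f k \<in> linear_maps A (P k) (Q k) \<and>
        (\<forall>x\<in>carrier (P (Suc k)). f k (dP k x) \<in> dQ k ` carrier (Q (Suc k))) \<and>
        (k = 0 \<longrightarrow> (\<forall>x\<in>carrier (P 0). eQ (f k x) = eP x))) \<and>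
      (\<forall>x\<in>carrier (P (Suc k)). dQ k (f (Suc k) x) = f k (dP k x))"
    (is "\<exists>f. \<forall>k. ?I k (f k) \<and> ?S k (f k) (f (Suc k))")
  proof (rule dependent_nat_choice)
    have "eP ` carrier (P 0) \<subseteq> eQ ` carrier (Q 0)"
      using onto linear_maps_closed[OF eP] by auto
    then obtain f where f: "f \<in> linear_maps A (P 0) (Q 0)"
      "\<And>x. x \<in> carrier (P 0) \<Longrightarrow> eQ (f x) = eP x"
      using rel_projective_lift_onto_image[OF A P(2) QM M eQ t eP] by blast
    have "f (dP 0 x) \<in> dQ 0 ` carrier (Q (Suc 0))" if x: "x \<in> carrier (P (Suc 0))" for x
      using linear_maps_closed[OF dP x] linear_maps_closed[OF f(1)]
      by (intro Q_complex(8)) (simp_all add: f(2) P_complex(6)[OF x])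
    then show "\<exists>f. ?I 0 f" using f by (intro exI[of _ f]) auto
  next
    fix f k assume "?I k f"
    then have f: "f \<in> linear_maps A (P k) (Q k)"
      and im: "(\<lambda>x. f (dP k x)) ` carrier (P (Suc k)) \<subseteq> dQ k ` carrier (Q (Suc k))" by auto
    obtain f' where f': "f' \<in> linear_maps A (P (Suc k)) (Q (Suc k))"
      "\<And>x. x \<in> carrier (P (Suc k)) \<Longrightarrow> dQ k (f' x) = f (dP k x)"
      using rel_projective_lift_onto_image[OF A P(2) QM QM dQ s linear_maps_comp[OF dP f] im] by blast
    have "f' (dP (Suc k) x) \<in> dQ (Suc k) ` carrier (Q (Suc (Suc k)))"
      if x: "x \<in> carrier (P (Suc (Suc k)))" for x
      using linear_maps_closed[OF dP x] linear_maps_closed[OF f'(1)] linear_maps_zero[OF PM QM f]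
      by (intro Q_complex(9)) (simp_all add: f'(2) P_complex(7)[OF x])
    then show "\<exists>f'. ?I (Suc k) f' \<and> ?S k f f'"
      using f' by (intro exI[of _ f']) auto
  qed
  then show thesis using that by metis
qed

text \<open>
  The difference of \<open>f\<close> and the identity is a chain map that the augmentation kills, so its degree
  zero part consists of boundaries and it is null homotopic.
\<close>

lemma endomorphism_homotopic_to_identity:
  fixes P :: "nat \<Rightarrow> ('a, 'p) module"
  assumes A: "assoc_algebra R A" and P: "rel_projective_resolution R A M P d e"
    and f: "\<And>k. f k \<in> linear_maps A (P k) (P k)"
    and aug: "\<And>x. x \<in> carrier (P 0) \<Longrightarrow> e (f 0 x) = e x"
    and chain: "\<And>k x. x \<in> carrier (P (Suc k)) \<Longrightarrow> d k (f (Suc k) x) = f k (d k x)"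
  obtains h where "\<And>k. h k \<in> linear_maps A (P k) (P (Suc k))"
    and "\<And>x. x \<in> carrier (P 0) \<Longrightarrow> f 0 x = x \<oplus>\<^bsub>P 0\<^esub> d 0 (h 0 x)"
    and "\<And>k x. x \<in> carrier (P (Suc k)) \<Longrightarrow>
      f (Suc k) x = (x \<oplus>\<^bsub>P (Suc k)\<^esub> d (Suc k) (h (Suc k) x)) \<oplus>\<^bsub>P (Suc k)\<^esub> h k (d k x)"
proof -
  have exact: "exact_augmented_complex A M P d e" and rel: "\<And>k. rel_projective R A (P k)"
    and split: "R_split_complex R A M P d e"
    using P by (simp_all add: rel_projective_resolution_def)
  note complex = exact_augmented_complexD[OF exact]
  note M = complex(1) and PM = complex(2) and e = complex(3) and d = complex(4)
  obtain s where s: "\<And>k. s k \<in> linear_maps R (restrict_scalars R A (P k)) (restrict_scalars R A (P (Suc k)))"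
    "\<And>k x. x \<in> carrier (P (Suc k)) \<Longrightarrow> d k (s k (d k x)) = d k x"
    using split by (auto simp: R_split_complex_def)
  interpret P: left_module A "P k" for k by (rule PM)
  interpret M: left_module A M by (rule M)
  let ?u = "\<lambda>k x. f k x \<ominus>\<^bsub>P k\<^esub> x"
  have u: "?u k \<in> linear_maps A (P k) (P k)" for k
    by (rule linear_maps_diff_of_maps[OF PM PM f linear_maps_id])
  have u0: "?u 0 ` carrier (P 0) \<subseteq> d 0 ` carrier (P (Suc 0))"
  proof (rule image_subsetI)
    fix x assume x: "x \<in> carrier (P 0)"
    have "e (?u 0 x) = \<zero>\<^bsub>M\<^esub>"
      using linear_maps_diff[OF PM M e linear_maps_closed[OF f x] x] linear_maps_closed[OF e x]
      by (simp add: aug x a_minus_def M.M.r_neg)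
    then show "?u 0 x \<in> d 0 ` carrier (P (Suc 0))"
      by (rule complex(8)[OF linear_maps_closed[OF u x]])
  qed
  have u_chain: "d k (?u (Suc k) x) = ?u k (d k x)" if x: "x \<in> carrier (P (Suc k))" for k x
    using linear_maps_diff[OF PM PM d linear_maps_closed[OF f x] x] by (simp add: chain x)
  have lift: "\<exists>h\<in>linear_maps A (P k) (P (Suc k)). \<forall>x\<in>carrier (P k). d k (h x) = g x"
    if "g \<in> linear_maps A (P k) (P k)" "g ` carrier (P k) \<subseteq> d k ` carrier (P (Suc k))" for k g
    by (rule rel_projective_lift_onto_image[OF A rel PM PM d s(1) _ that]) (rule s(2))
  obtain h where h: "\<And>k. h k \<in> linear_maps A (P k) (P (Suc k))"
    and h0: "\<And>x. x \<in> carrier (P 0) \<Longrightarrow> d 0 (h 0 x) = ?u 0 x"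
    and hS: "\<And>k x. x \<in> carrier (P (Suc k)) \<Longrightarrow>
      d (Suc k) (h (Suc k) x) = ?u (Suc k) x \<ominus>\<^bsub>P (Suc k)\<^esub> h k (d k x)"
  proof -
    show thesis
      by (rule null_homotopy[where P=P and Q=P and u="?u" and dP=d and dQ=d])
        (fact PM d complex(7) complex(9) lift u u0 u_chain that)+
  qed
  have cancel: "x \<oplus>\<^bsub>P k\<^esub> (y \<ominus>\<^bsub>P k\<^esub> x) = y" "(y \<ominus>\<^bsub>P k\<^esub> x) \<oplus>\<^bsub>P k\<^esub> x = y"
    if "x \<in> carrier (P k)" "y \<in> carrier (P k)" for x y k
    using that by (simp_all add: a_minus_def P.M.a_lcomm[of x k y] P.M.r_neg P.M.a_assoc P.M.l_neg)
  show thesis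
  proof (rule that[OF h])
    fix x assume x: "x \<in> carrier (P 0)"
    then show "f 0 x = x \<oplus>\<^bsub>P 0\<^esub> d 0 (h 0 x)"
      using linear_maps_closed[OF f x] by (simp add: h0 cancel)
  next
    fix k x assume x: "x \<in> carrier (P (Suc k))"
    have "f (Suc k) x \<in> carrier (P (Suc k))" "h k (d k x) \<in> carrier (P (Suc k))"
      using linear_maps_closed[OF f x] linear_maps_closed[OF h linear_maps_closed[OF d x]] by auto
    then show "f (Suc k) x = (x \<oplus>\<^bsub>P (Suc k)\<^esub> d (Suc k) (h (Suc k) x)) \<oplus>\<^bsub>P (Suc k)\<^esub> h k (d k x)"
      using x by (simp add: hS P.M.a_assoc cancel)
  qed
qed

text \<open>
  Let \<open>t\<close> be an \<open>R\<close>-linear section of the augmentation, which exists because \<open>M\<close> is free.  The map that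
  is \<open>id - t e\<close> in degree zero and the identity in higher degrees is a chain map over \<open>R\<close>, since
  \<open>e d = 0\<close>, and \<open>e (id - t e) = 0\<close>.  A null homotopy of it satisfies \<open>d h d = d\<close>.
\<close>

lemma projective_resolution_R_split:
  fixes Q :: "nat \<Rightarrow> ('a, 'q) module"
  assumes cring: "cring R" and A: "assoc_algebra R A" and free: "free_module R A"
    and freeM: "free_module R (restrict_scalars R A M)"
    and Q: "projective_resolution A M Q d e"
  shows "R_split_complex R A M Q d e"
proof -
  have exact: "exact_augmented_complex A M Q d e" and proj: "\<And>k. projective A (Q k)"
    using Q by (simp_all add: projective_resolution_def)
  note complex = exact_augmented_complexD[OF exact]
  note M = complex(1) and QM = complex(2) and e = complex(3) and d = complex(4) and onto = complex(5)
  let ?Q = "\<lambda>k. restrict_scalars R A (Q k)" and ?M = "restrict_scalars R A M"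
  have QR: "left_module R (?Q k)" for k
    by (rule left_module_of_module[OF module_restrict_scalars[OF A QM]])
  have MR: "left_module R ?M"
    by (rule left_module_of_module[OF module_restrict_scalars[OF A M]])
  have dR: "d k \<in> linear_maps R (?Q (Suc k)) (?Q k)" for k
    by (rule linear_maps_restrict[OF A d])
  have eR: "e \<in> linear_maps R (?Q 0) ?M"
    by (rule linear_maps_restrict[OF A e])
  have car [simp]: "carrier (restrict_scalars R A X) = carrier X"
    and zero: "\<zero>\<^bsub>restrict_scalars R A X\<^esub> = \<zero>\<^bsub>X\<^esub>" for X :: "('a, 'x) module"
    by (simp_all add: restrict_scalars_def)
  interpret QR: left_module R "?Q k" for k by (rule QR)
  interpret MR: left_module R ?M by (rule MR)
  have diff_zero: "x \<ominus>\<^bsub>?Q k\<^esub> \<zero>\<^bsub>?Q k\<^esub> = x" if "x \<in> carrier (?Q k)" for x k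
    using that QR.M.add.inv_one[of k] by (simp add: a_minus_def a_inv_def)
  have "(\<lambda>x. x) ` carrier ?M \<subseteq> e ` carrier (?Q 0)" by (simp add: onto)
  then obtain t where t: "t \<in> linear_maps R ?M (?Q 0)" "\<And>x. x \<in> carrier M \<Longrightarrow> e (t x) = x"
    using free_module_lift[OF cring MR freeM QR MR eR linear_maps_id] by auto
  \<comment> \<open>The complement of the idempotent \<open>t e\<close> in degree zero.\<close>
  let ?u = "\<lambda>k x. case k of 0 \<Rightarrow> x \<ominus>\<^bsub>?Q 0\<^esub> t (e x) | Suc j \<Rightarrow> x"
  have u: "?u k \<in> linear_maps R (?Q k) (?Q k)" for k
    using linear_maps_diff_of_maps[OF QR QR linear_maps_id linear_maps_comp[OF eR t(1)]]
    by (cases k) (simp_all add: linear_maps_id)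
  have dd: "d k (d (Suc k) x) = \<zero>\<^bsub>?Q k\<^esub>" if "x \<in> carrier (?Q (Suc (Suc k)))" for k x
    using complex(7) that by (simp add: zero)
  have exact: "y \<in> d (Suc k) ` carrier (?Q (Suc (Suc k)))"
    if "y \<in> carrier (?Q (Suc k))" "d k y = \<zero>\<^bsub>?Q k\<^esub>" for k y
    using complex(9) that by (simp add: zero)
  have ed: "e (d 0 x) = \<zero>\<^bsub>?M\<^esub>" if "x \<in> carrier (Q (Suc 0))" for x
    using complex(6) that by (simp add: zero)
  have u0: "?u 0 ` carrier (?Q 0) \<subseteq> d 0 ` carrier (?Q (Suc 0))"
  proof (rule image_subsetI)
    fix x assume x: "x \<in> carrier (?Q 0)"
    have "e (?u 0 x) = e x \<ominus>\<^bsub>?M\<^esub> e (t (e x))"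
      using linear_maps_diff[OF QR MR eR x linear_maps_closed[OF t(1) linear_maps_closed[OF eR x]]]
      by simp
    also have "\<dots> = \<zero>\<^bsub>?M\<^esub>"
      using MR.M.r_neg[OF linear_maps_closed[OF eR x]] linear_maps_closed[OF eR x]
      by (simp add: t(2) a_minus_def)
    finally show "?u 0 x \<in> d 0 ` carrier (?Q (Suc 0))"
      using complex(8) linear_maps_closed[OF u x] by (simp add: zero)
  qed
  have u_chain: "d k (?u (Suc k) x) = ?u k (d k x)" if x: "x \<in> carrier (?Q (Suc k))" for k x
    using x linear_maps_closed[OF dR x] linear_maps_zero[OF MR QR t(1)]
    by (cases k) (simp_all add: ed diff_zero)
  have lift: "\<exists>h\<in>linear_maps R (?Q k) (?Q (Suc k)). \<forall>x\<in>carrier (?Q k). d k (h x) = g x"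
    if "g \<in> linear_maps R (?Q k) (?Q k)" "g ` carrier (?Q k) \<subseteq> d k ` carrier (?Q (Suc k))" for k g
    using projective_lift_over_base_ring[OF cring A free proj QR QR dR] that by simp
  obtain h where h: "\<And>k. h k \<in> linear_maps R (?Q k) (?Q (Suc k))"
    and h0: "\<And>x. x \<in> carrier (?Q 0) \<Longrightarrow> d 0 (h 0 x) = ?u 0 x"
    and hS: "\<And>k x. x \<in> carrier (?Q (Suc k)) \<Longrightarrow>
      d (Suc k) (h (Suc k) x) = ?u (Suc k) x \<ominus>\<^bsub>?Q (Suc k)\<^esub> h k (d k x)"
  proof -
    show thesis
      by (rule null_homotopy[where P="?Q" and Q="?Q" and u="?u" and dP=d and dQ=d])
        (fact QR dR dd exact lift u u0 u_chain that)+
  qed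
  have "d k (h k (d k x)) = d k x" if x: "x \<in> carrier (Q (Suc k))" for k x
  proof (cases k)
    case 0
    then show ?thesis
      using u_chain[of x 0] h0[of "d 0 x"] x linear_maps_closed[OF d] by simp
  next
    case (Suc j)
    then show ?thesis
      using hS[of "d k x" j] dd[of x j] x linear_maps_closed[OF d, of x k]
        linear_maps_zero[OF QR QR h, of j] linear_maps_closed[OF dR, of x k]
      by (simp add: diff_zero)
  qed
  moreover have "e (t (e x)) = e x" if "x \<in> carrier (Q 0)" for x
    using t(2) linear_maps_closed[OF e that] .
  ultimately show ?thesis
    unfolding R_split_complex_def using t(1) h by blast
qed

section \<open>Homology isomorphisms\<close>

lemma subgroup_cycles:
  assumes C: "\<And>k. group (C k)" and d: "\<And>k. d k \<in> hom (C (Suc k)) (C k)"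
  shows "subgroup (cycles C d k) (C k)"
proof (cases k)
  case 0
  then show ?thesis using group.subgroup_self[OF C] by (simp add: cycles_def)
next
  case (Suc j)
  have "group_hom (C (Suc j)) (C j) (d j)"
    using C d by (simp add: group_hom_def group_hom_axioms_def)
  then show ?thesis using group_hom.subgroup_kernel Suc by (fastforce simp: cycles_def)
qed

text \<open>
  The composite of \<open>f\<close> with the projection from cycles to homology is onto because of \<open>fg\<close>, and its
  kernel is the group of boundaries because of \<open>gf\<close>.  Both conditions concern a single degree and
  follow from chain homotopies, whose other summand vanishes on cycles.
\<close>

lemma homology_iso:
  fixes C :: "nat \<Rightarrow> 'c monoid" and D :: "nat \<Rightarrow> 'd monoid"
  assumes C: "\<And>k. comm_group (C k)" and D: "\<And>k. comm_group (D k)"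
    and dC: "\<And>k. dC k \<in> hom (C (Suc k)) (C k)" and dD: "\<And>k. dD k \<in> hom (D (Suc k)) (D k)"
    and dC_dC: "dC k ` carrier (C (Suc k)) \<subseteq> cycles C dC k"
    and dD_dD: "dD k ` carrier (D (Suc k)) \<subseteq> cycles D dD k"
    and f: "f \<in> hom (C k) (D k)" and g: "g \<in> hom (D k) (C k)"
    and f_cycles: "f ` cycles C dC k \<subseteq> cycles D dD k"
    and g_cycles: "g ` cycles D dD k \<subseteq> cycles C dC k"
    and f_boundaries: "f ` dC k ` carrier (C (Suc k)) \<subseteq> dD k ` carrier (D (Suc k))"
    and g_boundaries: "g ` dD k ` carrier (D (Suc k)) \<subseteq> dC k ` carrier (C (Suc k))"
    and gf: "\<And>x. x \<in> cycles C dC k \<Longrightarrow> \<exists>y\<in>carrier (C (Suc k)). g (f x) = x \<otimes>\<^bsub>C k\<^esub> dC k y"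
    and fg: "\<And>x. x \<in> cycles D dD k \<Longrightarrow> \<exists>y\<in>carrier (D (Suc k)). f (g x) = x \<otimes>\<^bsub>D k\<^esub> dD k y"
  shows "homology C dC k \<cong> homology D dD k"
proof -
  interpret C: comm_group "C k" by (rule C)
  interpret D: comm_group "D k" by (rule D)
  have subC: "subgroup (cycles C dC k) (C k)" and subD: "subgroup (cycles D dD k) (D k)"
    using C D dC dD by (auto intro!: subgroup_cycles comm_group.axioms(2))
  have ZC_in: "x \<in> carrier (C k)" if "x \<in> cycles C dC k" for x
    using subgroup.subset[OF subC] that by auto
  have ZD_in: "x \<in> carrier (D k)" if "x \<in> cycles D dD k" for x
    using subgroup.subset[OF subD] that by auto
  let ?ZC = "(C k)\<lparr>carrier := cycles C dC k\<rparr>" and ?ZD = "(D k)\<lparr>carrier := cycles D dD k\<rparr>"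
  let ?BC = "dC k ` carrier (C (Suc k))" and ?BD = "dD k ` carrier (D (Suc k))"
  interpret ZC: group ?ZC using subC C.group_axioms by (rule subgroup.subgroup_is_group)
  interpret ZD: comm_group ?ZD
    using subgroup.subgroup_is_group[OF subD D.group_axioms] ZD_in
    by (auto intro!: group.group_comm_groupI D.m_comm)
  have BC: "subgroup ?BC (C k)"
    using C dC by (auto simp: group_hom_def group_hom_axioms_def
        intro!: group_hom.img_is_subgroup comm_group.axioms(2))
  have BD: "subgroup ?BD (D k)"
    using D dD by (auto simp: group_hom_def group_hom_axioms_def
        intro!: group_hom.img_is_subgroup comm_group.axioms(2))
  have BDZ: "subgroup ?BD ?ZD"
    using D.subgroup_incl[OF BD subD dD_dD] .
  interpret BD: normal ?BD ?ZD by (rule ZD.subgroup_imp_normal[OF BDZ])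
  interpret H: group "homology D dD k"
    unfolding homology_def by (rule BD.factorgroup_is_group)
  let ?h = "\<lambda>x. ?BD #>\<^bsub>?ZD\<^esub> f x"
  have f_hom: "f \<in> hom ?ZC ?ZD"
    using f f_cycles ZC_in by (auto simp: hom_def)
  have "?h \<in> hom ?ZC (homology D dD k)"
    using Group.hom_compose[OF f_hom BD.r_coset_hom_Mod] by (simp add: homology_def comp_def)
  then interpret h: group_hom ?ZC "homology D dD k" ?h
    by (intro group_hom.intro group_hom_axioms.intro ZC.group_axioms H.group_axioms)
  have coset_eq: "?BD #>\<^bsub>?ZD\<^esub> z = ?BD #>\<^bsub>?ZD\<^esub> y"
    if "y \<in> cycles D dD k" "b \<in> ?BD" "z = y \<otimes>\<^bsub>D k\<^esub> b" for y z b
  proof -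
    have "b \<in> carrier (D k)" using subgroup.subset[OF BD] that(2) by blast
    then have "z = b \<otimes>\<^bsub>?ZD\<^esub> y" using that(3) ZD_in[OF that(1)] D.m_comm by simp
    then have "z \<in> ?BD #>\<^bsub>?ZD\<^esub> y" using that(2) by (auto simp: r_coset_def)
    then show ?thesis using ZD.repr_independence[OF _ _ BDZ] that(1) by simp
  qed
  have onto: "?h ` carrier ?ZC = carrier (homology D dD k)"
  proof
    show "?h ` carrier ?ZC \<subseteq> carrier (homology D dD k)" using h.hom_closed by blast
    show "carrier (homology D dD k) \<subseteq> ?h ` carrier ?ZC"
    proof
      fix Y assume "Y \<in> carrier (homology D dD k)"
      then obtain y where y: "y \<in> cycles D dD k" "Y = ?BD #>\<^bsub>?ZD\<^esub> y"
        by (auto simp: homology_def FactGroup_def RCOSETS_def)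
      obtain b where "b \<in> ?BD" "f (g y) = y \<otimes>\<^bsub>D k\<^esub> b" using fg[OF y(1)] by blast
      then have "Y = ?h (g y)" using coset_eq[OF y(1)] y(2) by simp
      then show "Y \<in> ?h ` carrier ?ZC" using g_cycles y(1) by (auto intro!: image_eqI)
    qed
  qed
  have "kernel ?ZC (homology D dD k) ?h = ?BC"
  proof (intro equalityI subsetI)
    fix x assume "x \<in> kernel ?ZC (homology D dD k) ?h"
    then have x: "x \<in> cycles C dC k" and hx: "?BD #>\<^bsub>?ZD\<^esub> f x = ?BD"
      by (auto simp: kernel_def homology_def)
    have "f x \<in> ?BD"
      using ZD.rcos_self[OF _ BDZ, of "f x"] f_cycles x hx by auto
    then have gfx: "g (f x) \<in> ?BC" using g_boundaries by blast
    obtain y where y: "y \<in> ?BC" "g (f x) = x \<otimes>\<^bsub>C k\<^esub> y" using gf[OF x] by blast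
    have "y \<in> carrier (C k)" using y(1) subgroup.subset[OF BC] by blast
    then have "x = g (f x) \<otimes>\<^bsub>C k\<^esub> inv\<^bsub>C k\<^esub> y"
      using y(2) ZC_in[OF x] by (simp add: C.m_assoc)
    then show "x \<in> ?BC"
      using subgroup.m_closed[OF BC gfx subgroup.m_inv_closed[OF BC y(1)]] by simp
  next
    fix x assume x: "x \<in> ?BC"
    then have fx: "f x \<in> ?BD" using f_boundaries by blast
    have "?BD #>\<^bsub>?ZD\<^esub> f x = ?BD"
      using ZD.coset_join2[OF _ BDZ fx] fx dD_dD by auto
    then show "x \<in> kernel ?ZC (homology D dD k) ?h"
      using x dC_dC by (auto simp: kernel_def homology_def)
  qed
  then show ?thesis
    using h.FactGroup_iso[OF onto] by (simp add: homology_def)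
qed

section \<open>Functoriality of the tensor product\<close>

text \<open>
  The homomorphism of free abelian groups from which \<^const>\<open>tensor_map\<close> is induced.
\<close>

abbreviation (input) push :: "('m \<Rightarrow> 'l) \<Rightarrow> ('n \<times> 'm \<Rightarrow>\<^sub>0 int) \<Rightarrow> ('n \<times> 'l \<Rightarrow>\<^sub>0 int)" where
  "push f \<equiv> frag_extend (\<lambda>(n, m). frag_of (n, f m))"

abbreviation (input) pairs :: "('a, 'n) module \<Rightarrow> ('a, 'm) module \<Rightarrow> ('n \<times> 'm) set" where
  "pairs N M \<equiv> carrier N \<times> carrier M"

lemma keys_push:
  assumes "f \<in> carrier M \<rightarrow> carrier L" and "Poly_Mapping.keys z \<subseteq> pairs N M"
  shows "Poly_Mapping.keys (push f z) \<subseteq> pairs N L"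
  using assms by (intro order_trans[OF keys_frag_extend]) (fastforce split: if_splits)

context
  fixes A :: "('r, 'a) module" and N :: "('a, 'n) module"
  assumes N: "right_module A N"
begin

interpretation N: right_module A N by (rule N)

lemma tensor_relations_subgroup:
  fixes M :: "('a, 'm) module"
  assumes M: "left_module A M"
  shows "subgroup (tensor_relations A N M) (free_Abelian_group (pairs N M))"
proof -
  interpret M: left_module A M by (rule M)
  have [simp]: "Poly_Mapping.keys (a - b) \<subseteq> S"
    if "Poly_Mapping.keys a \<subseteq> S" "Poly_Mapping.keys b \<subseteq> S" for a b :: "'n \<times> 'm \<Rightarrow>\<^sub>0 int" and S
    using that keys_diff[of a b] by blast
  show ?thesis
    unfolding tensor_relations_def
    by (rule group.generate_is_subgroup) auto
qed

lemma tensor_relations_closed: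
  assumes M: "left_module A M"
  shows "0 \<in> tensor_relations A N M"
    and "z \<in> tensor_relations A N M \<Longrightarrow> w \<in> tensor_relations A N M \<Longrightarrow> z + w \<in> tensor_relations A N M"
    and "z \<in> tensor_relations A N M \<Longrightarrow> - z \<in> tensor_relations A N M"
    and "z \<in> tensor_relations A N M \<Longrightarrow> Poly_Mapping.keys z \<subseteq> pairs N M"
proof -
  note sub = tensor_relations_subgroup[OF M]
  show keys: "z \<in> tensor_relations A N M \<Longrightarrow> Poly_Mapping.keys z \<subseteq> pairs N M" for z
    using subsetD[OF subgroup.subset[OF sub]] by simp
  show "0 \<in> tensor_relations A N M" using subgroup.one_closed[OF sub] by simp
  show "z \<in> tensor_relations A N M \<Longrightarrow> w \<in> tensor_relations A N M \<Longrightarrow> z + w \<in> tensor_relations A N M"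
    using subgroup.m_closed[OF sub] by simp
  show "z \<in> tensor_relations A N M \<Longrightarrow> - z \<in> tensor_relations A N M"
    using subgroup.m_inv_closed[OF sub] keys by fastforce
qed

lemma tensor_relations_generators:
  shows "x \<in> carrier N \<Longrightarrow> x' \<in> carrier N \<Longrightarrow> y \<in> carrier M \<Longrightarrow>
      frag_of (x \<oplus>\<^bsub>N\<^esub> x', y) - frag_of (x, y) - frag_of (x', y) \<in> tensor_relations A N M"
    and "x \<in> carrier N \<Longrightarrow> y \<in> carrier M \<Longrightarrow> y' \<in> carrier M \<Longrightarrow>
      frag_of (x, y \<oplus>\<^bsub>M\<^esub> y') - frag_of (x, y) - frag_of (x, y') \<in> tensor_relations A N M"
    and "a \<in> carrier A \<Longrightarrow> x \<in> carrier N \<Longrightarrow> y \<in> carrier M \<Longrightarrow>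
      frag_of (a \<odot>\<^bsub>N\<^esub> x, y) - frag_of (x, a \<odot>\<^bsub>M\<^esub> y) \<in> tensor_relations A N M"
  unfolding tensor_relations_def by (rule generate.incl; blast)+

lemma tensor_relations_normal:
  assumes M: "left_module A M"
  shows "tensor_relations A N M \<lhd> free_Abelian_group (pairs N M)"
  by (rule comm_group.subgroup_imp_normal[OF abelian_free_Abelian_group tensor_relations_subgroup[OF M]])

lemma tensor_coset_eqI:
  assumes M: "left_module A M" and z: "Poly_Mapping.keys z \<subseteq> pairs N M"
    and w: "w - z \<in> tensor_relations A N M"
  shows "tensor_relations A N M #>\<^bsub>free_Abelian_group (pairs N M)\<^esub> w =
    tensor_relations A N M #>\<^bsub>free_Abelian_group (pairs N M)\<^esub> z"
proof -
  have "w \<in> tensor_relations A N M #>\<^bsub>free_Abelian_group (pairs N M)\<^esub> z"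
    using w by (auto simp: r_coset_def intro!: bexI[of _ "w - z"])
  then show ?thesis
    using group.repr_independence[OF group_free_Abelian_group _ _ tensor_relations_subgroup[OF M]] z
    by (metis carrier_free_Abelian_group_iff)
qed

lemma tensor_product_comm_group:
  assumes M: "left_module A M"
  shows "comm_group (tensor_product A N M)"
  unfolding tensor_product_def
  by (rule comm_group.abelian_FactGroup[OF abelian_free_Abelian_group tensor_relations_subgroup[OF M]])

lemma tensor_product_mult:
  assumes M: "left_module A M"
    and "Poly_Mapping.keys z \<subseteq> pairs N M" "Poly_Mapping.keys w \<subseteq> pairs N M"
  shows "(tensor_relations A N M #>\<^bsub>free_Abelian_group (pairs N M)\<^esub> z) \<otimes>\<^bsub>tensor_product A N M\<^esub>
      (tensor_relations A N M #>\<^bsub>free_Abelian_group (pairs N M)\<^esub> w) =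
    tensor_relations A N M #>\<^bsub>free_Abelian_group (pairs N M)\<^esub> (z + w)"
  using assms normal.rcos_sum[OF tensor_relations_normal[OF M]]
  by (simp add: tensor_product_def FactGroup_def)

lemma tensor_product_carrierE:
  assumes "X \<in> carrier (tensor_product A N M)"
  obtains z where "Poly_Mapping.keys z \<subseteq> pairs N M"
    "X = tensor_relations A N M #>\<^bsub>free_Abelian_group (pairs N M)\<^esub> z"
  using assms by (auto simp: tensor_product_def FactGroup_def RCOSETS_def)

lemma tensor_product_carrierI:
  assumes "Poly_Mapping.keys z \<subseteq> pairs N M"
  shows "tensor_relations A N M #>\<^bsub>free_Abelian_group (pairs N M)\<^esub> z \<in> carrier (tensor_product A N M)"
  using assms by (auto simp: tensor_product_def FactGroup_def RCOSETS_def)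

text \<open>
  The formal combinations that \<open>push f\<close> sends to relations form a subgroup, so it is enough to look at
  the three kinds of generators.
\<close>

lemma push_relations:
  assumes M: "left_module A M" and L: "left_module A L" and f: "f \<in> linear_maps A M L"
    and z: "z \<in> tensor_relations A N M"
  shows "push f z \<in> tensor_relations A N L"
proof -
  interpret M: left_module A M by (rule M)
  let ?F = "free_Abelian_group (pairs N M)" and ?T = "tensor_relations A N L"
  let ?K = "{z \<in> carrier ?F. push f z \<in> ?T}"
  note closed = tensor_relations_closed[OF L] and fcl = linear_maps_closed[OF f]
  have sub: "subgroup ?K ?F"
    by (rule group.subgroupI[OF group_free_Abelian_group])
      (auto simp: closed frag_extend_add frag_extend_minus intro: exI[of _ 0]
        dest: subsetD[OF keys_add])
  have "tensor_relations A N M \<subseteq> ?K"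
    unfolding tensor_relations_def[of A N M]
  proof (rule group.generate_subgroup_incl[OF group_free_Abelian_group _ sub])
    show "{frag_of (x \<oplus>\<^bsub>N\<^esub> x', y) - frag_of (x, y) - frag_of (x', y) | x x' y.
         x \<in> carrier N \<and> x' \<in> carrier N \<and> y \<in> carrier M} \<union>
      {frag_of (x, y \<oplus>\<^bsub>M\<^esub> y') - frag_of (x, y) - frag_of (x, y') | x y y'.
         x \<in> carrier N \<and> y \<in> carrier M \<and> y' \<in> carrier M} \<union>
      {frag_of (a \<odot>\<^bsub>N\<^esub> x, y) - frag_of (x, a \<odot>\<^bsub>M\<^esub> y) | a x y.
         a \<in> carrier A \<and> x \<in> carrier N \<and> y \<in> carrier M} \<subseteq> ?K"
      (is "?gens \<subseteq> ?K")
    proof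
      fix x assume x: "x \<in> ?gens"
      then have "x \<in> tensor_relations A N M"
        unfolding tensor_relations_def by (rule generate.incl)
      then have "x \<in> carrier ?F" using tensor_relations_closed(4)[OF M] by simp
      moreover have "push f x \<in> ?T"
        using x by (auto simp: frag_extend_diff linear_maps_add[OF f] linear_maps_smult[OF f]
            tensor_relations_generators fcl)
      ultimately show "x \<in> ?K" by simp
    qed
  qed
  then show ?thesis using z by blast
qed

text \<open>
  The union in the definition of \<^const>\<open>tensor_map\<close> ranges over all representatives of a coset; by
  \<open>push_relations\<close> they all contribute the same coset.
\<close>

lemma tensor_map_coset:
  assumes M: "left_module A M" and L: "left_module A L" and f: "f \<in> linear_maps A M L"
    and z: "Poly_Mapping.keys z \<subseteq> pairs N M"
  shows "tensor_map A N L f (tensor_relations A N M #>\<^bsub>free_Abelian_group (pairs N M)\<^esub> z) =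
    tensor_relations A N L #>\<^bsub>free_Abelian_group (pairs N L)\<^esub> push f z"
proof -
  have "f \<in> carrier M \<rightarrow> carrier L" using f by (simp add: linear_maps_def)
  then have fz: "Poly_Mapping.keys (push f z) \<subseteq> pairs N L" using z by (rule keys_push)
  have "tensor_relations A N L #>\<^bsub>free_Abelian_group (pairs N L)\<^esub> push f (t + z) =
      tensor_relations A N L #>\<^bsub>free_Abelian_group (pairs N L)\<^esub> push f z"
    if t: "t \<in> tensor_relations A N M" for t
    by (rule tensor_coset_eqI[OF L fz]) (simp add: frag_extend_add push_relations[OF M L f t])
  moreover have "z \<in> tensor_relations A N M #>\<^bsub>free_Abelian_group (pairs N M)\<^esub> z"
    using tensor_relations_closed(1)[OF M] by (force simp: r_coset_def)
  ultimately show ?thesis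
    unfolding tensor_map_def by (auto simp: r_coset_def)
qed

lemma tensor_map_hom:
  assumes M: "left_module A M" and L: "left_module A L" and f: "f \<in> linear_maps A M L"
  shows "tensor_map A N L f \<in> hom (tensor_product A N M) (tensor_product A N L)"
proof -
  have f': "f \<in> carrier M \<rightarrow> carrier L" using f by (simp add: linear_maps_def)
  show ?thesis
  proof (rule homI)
    fix X assume "X \<in> carrier (tensor_product A N M)"
    then show "tensor_map A N L f X \<in> carrier (tensor_product A N L)"
      by (elim tensor_product_carrierE)
        (simp add: tensor_map_coset[OF M L f] tensor_product_carrierI keys_push[OF f'])
  next
    fix X Y assume "X \<in> carrier (tensor_product A N M)" "Y \<in> carrier (tensor_product A N M)"
    then obtain x y where
      x: "Poly_Mapping.keys x \<subseteq> pairs N M" "X = tensor_relations A N M #>\<^bsub>free_Abelian_group (pairs N M)\<^esub> x" and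
      y: "Poly_Mapping.keys y \<subseteq> pairs N M" "Y = tensor_relations A N M #>\<^bsub>free_Abelian_group (pairs N M)\<^esub> y"
      by (elim tensor_product_carrierE)
    have "Poly_Mapping.keys (x + y) \<subseteq> pairs N M" using x y keys_add[of x y] by blast
    then show "tensor_map A N L f (X \<otimes>\<^bsub>tensor_product A N M\<^esub> Y) =
        tensor_map A N L f X \<otimes>\<^bsub>tensor_product A N L\<^esub> tensor_map A N L f Y"
      using x y by (simp add: tensor_product_mult M L tensor_map_coset[OF M L f] frag_extend_add
          keys_push[OF f'])
  qed
qed

text \<open>
  Needed because linear maps are functions on a whole type: identities between them hold on carriers
  only.
\<close>

lemma tensor_map_cong:
  assumes M: "left_module A M" and L: "left_module A L"
    and f: "f \<in> linear_maps A M L" and g: "g \<in> linear_maps A M L"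
    and eq: "\<And>x. x \<in> carrier M \<Longrightarrow> f x = g x"
    and X: "X \<in> carrier (tensor_product A N M)"
  shows "tensor_map A N L f X = tensor_map A N L g X"
  using X
proof (elim tensor_product_carrierE)
  fix z assume z: "Poly_Mapping.keys z \<subseteq> pairs N M"
    and X: "X = tensor_relations A N M #>\<^bsub>free_Abelian_group (pairs N M)\<^esub> z"
  have "push f z = push g z"
    by (rule frag_extend_eq) (use z eq in auto)
  then show ?thesis by (simp add: X tensor_map_coset[OF M L f z] tensor_map_coset[OF M L g z])
qed

lemma tensor_map_id:
  fixes M :: "('a, 'm) module"
  assumes M: "left_module A M" and X: "X \<in> carrier (tensor_product A N M)"
  shows "tensor_map A N M (\<lambda>x. x) X = X"
  using X
proof (elim tensor_product_carrierE)
  fix z assume z: "Poly_Mapping.keys z \<subseteq> pairs N M"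
    and X: "X = tensor_relations A N M #>\<^bsub>free_Abelian_group (pairs N M)\<^esub> z"
  show ?thesis
    using case_prod_eta[of "frag_of :: 'n \<times> 'm \<Rightarrow> _"]
    by (simp add: X tensor_map_coset[OF M M linear_maps_id z] frag_expansion[symmetric])
qed

lemma tensor_map_comp:
  assumes M: "left_module A M" and L: "left_module A L" and K: "left_module A K"
    and f: "f \<in> linear_maps A M L" and g: "g \<in> linear_maps A L K"
    and X: "X \<in> carrier (tensor_product A N M)"
  shows "tensor_map A N K g (tensor_map A N L f X) = tensor_map A N K (\<lambda>x. g (f x)) X"
  using X
proof (elim tensor_product_carrierE)
  fix z assume z: "Poly_Mapping.keys z \<subseteq> pairs N M"
    and X: "X = tensor_relations A N M #>\<^bsub>free_Abelian_group (pairs N M)\<^esub> z"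
  have fz: "Poly_Mapping.keys (push f z) \<subseteq> pairs N L"
    by (rule keys_push[OF _ z]) (use f in \<open>simp add: linear_maps_def\<close>)
  have "push g (push f z) = push (\<lambda>x. g (f x)) z"
    by (rule free_Abelian_group_induct[OF z, where P="\<lambda>z. push g (push f z) = push (\<lambda>x. g (f x)) z"])
      (auto simp: frag_extend_diff)
  then show ?thesis
    by (simp add: X tensor_map_coset[OF M L f z] tensor_map_coset[OF L K g fz]
        tensor_map_coset[OF M K linear_maps_comp[OF f g] z])
qed

text \<open>
  On a generator \<open>(n, m)\<close> the difference of the two sides is one of the defining relations, and both
  sides are additive in the formal combination.
\<close>

lemma tensor_map_add:
  assumes M: "left_module A M" and L: "left_module A L"
    and f: "f \<in> linear_maps A M L" and g: "g \<in> linear_maps A M L"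
    and X: "X \<in> carrier (tensor_product A N M)"
  shows "tensor_map A N L (\<lambda>x. f x \<oplus>\<^bsub>L\<^esub> g x) X =
    tensor_map A N L f X \<otimes>\<^bsub>tensor_product A N L\<^esub> tensor_map A N L g X"
  using X
proof (elim tensor_product_carrierE)
  fix z assume z: "Poly_Mapping.keys z \<subseteq> pairs N M"
    and X: "X = tensor_relations A N M #>\<^bsub>free_Abelian_group (pairs N M)\<^esub> z"
  let ?fg = "\<lambda>x. f x \<oplus>\<^bsub>L\<^esub> g x"
  note fg = linear_maps_sum_of_maps[OF M L f g]
  have kz: "Poly_Mapping.keys (push f z) \<subseteq> pairs N L" "Poly_Mapping.keys (push g z) \<subseteq> pairs N L"
    by (rule keys_push[OF _ z], use f g in \<open>simp add: linear_maps_def\<close>)+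
  then have kz': "Poly_Mapping.keys (push f z + push g z) \<subseteq> pairs N L"
    using keys_add[of "push f z" "push g z"] by (meson Un_least order_trans)
  note closed = tensor_relations_closed[OF L]
  have "push ?fg z - (push f z + push g z) \<in> tensor_relations A N L"
  proof (rule free_Abelian_group_induct[OF z,
        where P="\<lambda>z. push ?fg z - (push f z + push g z) \<in> tensor_relations A N L"])
    show "push ?fg 0 - (push f 0 + push g 0) \<in> tensor_relations A N L" by (simp add: closed)
  next
    fix x y
    assume "push ?fg x - (push f x + push g x) \<in> tensor_relations A N L"
      and "push ?fg y - (push f y + push g y) \<in> tensor_relations A N L"
    then have "(push ?fg x - (push f x + push g x)) + - (push ?fg y - (push f y + push g y))
        \<in> tensor_relations A N L"
      by (intro closed(2,3))
    then show "push ?fg (x - y) - (push f (x - y) + push g (x - y)) \<in> tensor_relations A N L"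
      by (simp add: frag_extend_diff algebra_simps)
  next
    fix a assume "a \<in> pairs N M"
    then obtain n m where a: "a = (n, m)" "n \<in> carrier N" "m \<in> carrier M" by auto
    have "frag_of (n, f m \<oplus>\<^bsub>L\<^esub> g m) - frag_of (n, f m) - frag_of (n, g m) \<in> tensor_relations A N L"
      by (rule tensor_relations_generators(2))
        (use a linear_maps_closed[OF f] linear_maps_closed[OF g] in blast)+
    then show "push ?fg (frag_of a) - (push f (frag_of a) + push g (frag_of a)) \<in> tensor_relations A N L"
      by (simp add: a diff_diff_eq)
  qed
  from tensor_coset_eqI[OF L kz' this] show ?thesis
    by (simp add: X tensor_map_coset[OF M L f z] tensor_map_coset[OF M L g z]
        tensor_map_coset[OF M L fg z] tensor_product_mult[OF L kz])
qed

lemma tensor_map_zero: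
  assumes M: "left_module A M" and L: "left_module A L"
    and X: "X \<in> carrier (tensor_product A N M)"
  shows "tensor_map A N L (\<lambda>x. \<zero>\<^bsub>L\<^esub>) X = \<one>\<^bsub>tensor_product A N L\<^esub>"
proof -
  interpret L: left_module A L by (rule L)
  interpret T: comm_group "tensor_product A N L" by (rule tensor_product_comm_group[OF L])
  note zero = linear_maps_zero_map[OF M L]
  have "tensor_map A N L (\<lambda>x. \<zero>\<^bsub>L\<^esub>) X \<otimes>\<^bsub>tensor_product A N L\<^esub> tensor_map A N L (\<lambda>x. \<zero>\<^bsub>L\<^esub>) X =
      tensor_map A N L (\<lambda>x. \<zero>\<^bsub>L\<^esub>) X"
    using tensor_map_add[OF M L zero zero X] by simp
  then show ?thesis
    using hom_in_carrier[OF tensor_map_hom[OF M L zero] X] by simp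
qed

end

section \<open>Independence of the resolution\<close>

lemma tensor_map_square:
  assumes N: "right_module A N"
    and modules: "left_module A P'" "left_module A P" "left_module A Q'" "left_module A Q"
    and d: "d \<in> linear_maps A P' P" and e: "e \<in> linear_maps A Q' Q"
    and f': "f' \<in> linear_maps A P' Q'" and f: "f \<in> linear_maps A P Q"
    and square: "\<And>x. x \<in> carrier P' \<Longrightarrow> e (f' x) = f (d x)"
    and X: "X \<in> carrier (tensor_product A N P')"
  shows "tensor_map A N Q e (tensor_map A N Q' f' X) = tensor_map A N Q f (tensor_map A N P d X)"
  unfolding tensor_map_comp[OF N modules(1,3,4) f' e X] tensor_map_comp[OF N modules(1,2,4) d f X]
  by (rule tensor_map_cong[OF N modules(1,4) linear_maps_comp[OF f' e] linear_maps_comp[OF d f]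
        square X])

lemma tensor_chain_map_cycles:
  assumes N: "right_module A N"
    and P: "\<And>k. left_module A (P k)" and dP: "\<And>k. dP k \<in> linear_maps A (P (Suc k)) (P k)"
    and Q: "\<And>k. left_module A (Q k)" and dQ: "\<And>k. dQ k \<in> linear_maps A (Q (Suc k)) (Q k)"
    and f: "\<And>k. f k \<in> linear_maps A (P k) (Q k)"
    and chain: "\<And>k x. x \<in> carrier (P (Suc k)) \<Longrightarrow> dQ k (f (Suc k) x) = f k (dP k x)"
  shows "tensor_map A N (Q k) (f k) `
      cycles (\<lambda>j. tensor_product A N (P j)) (\<lambda>j. tensor_map A N (P j) (dP j)) k \<subseteq>
      cycles (\<lambda>j. tensor_product A N (Q j)) (\<lambda>j. tensor_map A N (Q j) (dQ j)) k" (is ?cycles)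
    and "tensor_map A N (Q k) (f k) ` tensor_map A N (P k) (dP k) `
        carrier (tensor_product A N (P (Suc k))) \<subseteq>
      tensor_map A N (Q k) (dQ k) ` carrier (tensor_product A N (Q (Suc k)))" (is ?boundaries)
proof -
  note hom = hom_in_carrier[OF tensor_map_hom[OF N P Q f]]
  note square = tensor_map_square[OF N P P Q Q dP dQ f f chain]
  show ?boundaries
    using square[symmetric] hom by auto
  show ?cycles
  proof (cases k)
    case 0
    then show ?thesis using hom by (auto simp: cycles_def)
  next
    case (Suc j)
    have "tensor_map A N (Q j) (f j) \<one>\<^bsub>tensor_product A N (P j)\<^esub> = \<one>\<^bsub>tensor_product A N (Q j)\<^esub>"
      by (rule hom_one[OF tensor_map_hom[OF N P Q f]])
        (simp_all add: comm_group.axioms(2) tensor_product_comm_group[OF N] P Q)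
    then show ?thesis using hom square by (auto simp: Suc cycles_def kernel_def)
  qed
qed

lemma tensor_differential_squared:
  assumes N: "right_module A N" and P: "exact_augmented_complex A M P d e"
  shows "tensor_map A N (P k) (d k) ` carrier (tensor_product A N (P (Suc k))) \<subseteq>
    cycles (\<lambda>j. tensor_product A N (P j)) (\<lambda>j. tensor_map A N (P j) (d j)) k"
proof -
  note complex = exact_augmented_complexD[OF P]
  note PM = complex(2) and d = complex(4)
  note hom = hom_in_carrier[OF tensor_map_hom[OF N PM PM d]]
  show ?thesis
  proof (cases k)
    case 0
    then show ?thesis using hom by (auto simp: cycles_def)
  next
    case (Suc j)
    have "tensor_map A N (P j) (d j) (tensor_map A N (P (Suc j)) (d (Suc j)) X) =
        \<one>\<^bsub>tensor_product A N (P j)\<^esub>"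
      if X: "X \<in> carrier (tensor_product A N (P (Suc (Suc j))))" for X
      unfolding tensor_map_comp[OF N PM PM PM d d X] tensor_map_zero[OF N PM PM X, symmetric]
      by (rule tensor_map_cong[OF N PM PM linear_maps_comp[OF d d] linear_maps_zero_map[OF PM PM]
            complex(7) X])
    then show ?thesis using hom by (auto simp: Suc cycles_def kernel_def)
  qed
qed

text \<open>
  Apply \<open>N \<otimes> _\<close> to \<open>f = id + d h + h d\<close>.  On a cycle \<open>X\<close> the last summand contributes the neutral
  element, so \<open>X\<close> and its image differ by the boundary of \<open>(N \<otimes> h) X\<close>.
\<close>

lemma tensor_homotopy:
  fixes P :: "nat \<Rightarrow> ('a, 'p) module"
  assumes N: "right_module A N" and A: "assoc_algebra R A"
    and P: "rel_projective_resolution R A M P d e"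
    and f: "\<And>k. f k \<in> linear_maps A (P k) (P k)"
    and aug: "\<And>x. x \<in> carrier (P 0) \<Longrightarrow> e (f 0 x) = e x"
    and chain: "\<And>k x. x \<in> carrier (P (Suc k)) \<Longrightarrow> d k (f (Suc k) x) = f k (d k x)"
    and X: "X \<in> cycles (\<lambda>j. tensor_product A N (P j)) (\<lambda>j. tensor_map A N (P j) (d j)) k"
  shows "\<exists>Y\<in>carrier (tensor_product A N (P (Suc k))).
    tensor_map A N (P k) (f k) X = X \<otimes>\<^bsub>tensor_product A N (P k)\<^esub> tensor_map A N (P k) (d k) Y"
proof -
  have exact: "exact_augmented_complex A M P d e"
    using P by (simp add: rel_projective_resolution_def)
  note complex = exact_augmented_complexD[OF exact]
  note PM = complex(2) and d = complex(4)
  interpret T: comm_group "tensor_product A N (P j)" for j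
    by (rule tensor_product_comm_group[OF N PM])
  obtain h where h: "\<And>k. h k \<in> linear_maps A (P k) (P (Suc k))"
    and h0: "\<And>x. x \<in> carrier (P 0) \<Longrightarrow> f 0 x = x \<oplus>\<^bsub>P 0\<^esub> d 0 (h 0 x)"
    and hS: "\<And>k x. x \<in> carrier (P (Suc k)) \<Longrightarrow>
      f (Suc k) x = (x \<oplus>\<^bsub>P (Suc k)\<^esub> d (Suc k) (h (Suc k) x)) \<oplus>\<^bsub>P (Suc k)\<^esub> h k (d k x)"
    using endomorphism_homotopic_to_identity[OF A P f aug chain] by blast
  note dh = linear_maps_comp[OF h d] and hd = linear_maps_comp[OF d h]
  note id_dh = linear_maps_sum_of_maps[OF PM PM linear_maps_id dh]
  show ?thesis
  proof (cases k)
    case 0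
    have X0: "X \<in> carrier (tensor_product A N (P 0))" using X unfolding 0 by (simp add: cycles_def)
    have "tensor_map A N (P 0) (f 0) X = tensor_map A N (P 0) (\<lambda>x. x \<oplus>\<^bsub>P 0\<^esub> d 0 (h 0 x)) X"
      by (rule tensor_map_cong[OF N PM PM f id_dh h0 X0])
    also have "\<dots> = X \<otimes>\<^bsub>tensor_product A N (P 0)\<^esub>
        tensor_map A N (P 0) (d 0) (tensor_map A N (P (Suc 0)) (h 0) X)"
      by (simp add: tensor_map_add[OF N PM PM linear_maps_id dh X0] tensor_map_id[OF N PM X0]
          tensor_map_comp[OF N PM PM PM h d X0])
    finally show ?thesis
      using hom_in_carrier[OF tensor_map_hom[OF N PM PM h] X0] 0 by blast
  next
    case (Suc j)
    then have XS: "X \<in> carrier (tensor_product A N (P (Suc j)))"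
      and cycle: "tensor_map A N (P j) (d j) X = \<one>\<^bsub>tensor_product A N (P j)\<^esub>"
      using X by (auto simp: cycles_def kernel_def)
    let ?Y = "tensor_map A N (P (Suc (Suc j))) (h (Suc j)) X"
    have Y: "?Y \<in> carrier (tensor_product A N (P (Suc (Suc j))))"
      by (rule hom_in_carrier[OF tensor_map_hom[OF N PM PM h] XS])
    have "tensor_map A N (P (Suc j)) (\<lambda>x. h j (d j x)) X =
        tensor_map A N (P (Suc j)) (h j) \<one>\<^bsub>tensor_product A N (P j)\<^esub>"
      by (simp add: tensor_map_comp[OF N PM PM PM d h XS, symmetric] cycle)
    also have "\<dots> = \<one>\<^bsub>tensor_product A N (P (Suc j))\<^esub>"
      by (rule hom_one[OF tensor_map_hom[OF N PM PM h]]) (rule T.group_axioms)+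
    finally have hd1: "tensor_map A N (P (Suc j)) (\<lambda>x. h j (d j x)) X =
        \<one>\<^bsub>tensor_product A N (P (Suc j))\<^esub>" .
    have "tensor_map A N (P (Suc j)) (f (Suc j)) X = tensor_map A N (P (Suc j))
        (\<lambda>x. (x \<oplus>\<^bsub>P (Suc j)\<^esub> d (Suc j) (h (Suc j) x)) \<oplus>\<^bsub>P (Suc j)\<^esub> h j (d j x)) X"
      by (rule tensor_map_cong[OF N PM PM f linear_maps_sum_of_maps[OF PM PM id_dh hd] hS XS])
    also have "\<dots> = (X \<otimes>\<^bsub>tensor_product A N (P (Suc j))\<^esub>
        tensor_map A N (P (Suc j)) (d (Suc j)) ?Y) \<otimes>\<^bsub>tensor_product A N (P (Suc j))\<^esub>
        \<one>\<^bsub>tensor_product A N (P (Suc j))\<^esub>"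
      by (simp add: tensor_map_add[OF N PM PM id_dh hd XS] hd1
          tensor_map_add[OF N PM PM linear_maps_id dh XS] tensor_map_id[OF N PM XS]
          tensor_map_comp[OF N PM PM PM h d XS])
    also have "\<dots> = X \<otimes>\<^bsub>tensor_product A N (P (Suc j))\<^esub> tensor_map A N (P (Suc j)) (d (Suc j)) ?Y"
      using XS hom_in_carrier[OF tensor_map_hom[OF N PM PM d] Y] by simp
    finally show ?thesis using Y Suc by blast
  qed
qed

theorem Tor_independent_of_rel_projective_resolution:
  fixes P :: "nat \<Rightarrow> ('a, 'p) module" and Q :: "nat \<Rightarrow> ('a, 'q) module"
  assumes A: "assoc_algebra R A" and N: "right_module A N"
    and P: "rel_projective_resolution R A M P dP eP"
    and Q: "rel_projective_resolution R A M Q dQ eQ"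
  shows "Tor_of_resolution A N P dP k \<cong> Tor_of_resolution A N Q dQ k"
proof -
  have exP: "exact_augmented_complex A M P dP eP" and relP: "\<And>k. rel_projective R A (P k)"
    and splitP: "R_split_complex R A M P dP eP"
    and exQ: "exact_augmented_complex A M Q dQ eQ" and relQ: "\<And>k. rel_projective R A (Q k)"
    and splitQ: "R_split_complex R A M Q dQ eQ"
    using P Q by (simp_all add: rel_projective_resolution_def)
  note PM = exact_augmented_complexD(2)[OF exP] and dP = exact_augmented_complexD(4)[OF exP]
  note QM = exact_augmented_complexD(2)[OF exQ] and dQ = exact_augmented_complexD(4)[OF exQ]
  obtain f where f: "\<And>k. f k \<in> linear_maps A (P k) (Q k)"
    and f_aug: "\<And>x. x \<in> carrier (P 0) \<Longrightarrow> eQ (f 0 x) = eP x"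
    and f_chain: "\<And>k x. x \<in> carrier (P (Suc k)) \<Longrightarrow> dQ k (f (Suc k) x) = f k (dP k x)"
  proof -
    show thesis by (rule comparison_map[OF A exP relP exQ splitQ]) (fact that)
  qed
  obtain g where g: "\<And>k. g k \<in> linear_maps A (Q k) (P k)"
    and g_aug: "\<And>x. x \<in> carrier (Q 0) \<Longrightarrow> eP (g 0 x) = eQ x"
    and g_chain: "\<And>k x. x \<in> carrier (Q (Suc k)) \<Longrightarrow> dP k (g (Suc k) x) = g k (dQ k x)"
  proof -
    show thesis by (rule comparison_map[OF A exQ relQ exP splitP]) (fact that)
  qed
  let ?C = "\<lambda>j. tensor_product A N (P j)" and ?dC = "\<lambda>j. tensor_map A N (P j) (dP j)"
  let ?D = "\<lambda>j. tensor_product A N (Q j)" and ?dD = "\<lambda>j. tensor_map A N (Q j) (dQ j)"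
  have subC: "X \<in> carrier (?C k)" if "X \<in> cycles ?C ?dC k" for X
    using that by (cases k) (auto simp: cycles_def kernel_def)
  have subD: "X \<in> carrier (?D k)" if "X \<in> cycles ?D ?dD k" for X
    using that by (cases k) (auto simp: cycles_def kernel_def)
  have gf: "\<exists>Y\<in>carrier (?C (Suc k)). tensor_map A N (P k) (g k) (tensor_map A N (Q k) (f k) X) =
      X \<otimes>\<^bsub>?C k\<^esub> ?dC k Y" if X: "X \<in> cycles ?C ?dC k" for X
    unfolding tensor_map_comp[OF N PM QM PM f g subC[OF X]]
  proof (rule tensor_homotopy[OF N A P _ _ _ X])
    show "(\<lambda>x. g k (f k x)) \<in> linear_maps A (P k) (P k)" for k by (rule linear_maps_comp[OF f g])
  qed (simp_all add: f_aug g_aug f_chain g_chain linear_maps_closed[OF f])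
  have fg: "\<exists>Y\<in>carrier (?D (Suc k)). tensor_map A N (Q k) (f k) (tensor_map A N (P k) (g k) X) =
      X \<otimes>\<^bsub>?D k\<^esub> ?dD k Y" if X: "X \<in> cycles ?D ?dD k" for X
    unfolding tensor_map_comp[OF N QM PM QM g f subD[OF X]]
  proof (rule tensor_homotopy[OF N A Q _ _ _ X])
    show "(\<lambda>x. f k (g k x)) \<in> linear_maps A (Q k) (Q k)" for k by (rule linear_maps_comp[OF g f])
  qed (simp_all add: f_aug g_aug f_chain g_chain linear_maps_closed[OF g])
  show ?thesis
    unfolding Tor_of_resolution_def
    by (rule homology_iso[where C="?C" and D="?D" and dC="?dC" and dD="?dD" and
          f="tensor_map A N (Q k) (f k)" and g="tensor_map A N (P k) (g k)"])
      (intro tensor_product_comm_group[OF N] tensor_map_hom[OF N] PM QM dP dQ f g gf fg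
        tensor_differential_squared[OF N exP] tensor_differential_squared[OF N exQ]
        tensor_chain_map_cycles[where P=P and dP=dP and Q=Q and dQ=dQ and f=f, OF N PM dP QM dQ f f_chain]
        tensor_chain_map_cycles[where P=Q and dP=dQ and Q=P and dQ=dP and f=g, OF N QM dQ PM dP g g_chain]; assumption)+
qed

theorem proposition4p2:
  fixes R :: "'r ring" and A :: "('r, 'a) module" and I :: "'a set" and M :: "('a, 'm) module"
    and P :: "nat \<Rightarrow> ('a, 'p) module" and dP :: "nat \<Rightarrow> 'p \<Rightarrow> 'p" and eP :: "'p \<Rightarrow> 'm"
    and Q :: "nat \<Rightarrow> ('a, 'q) module" and dQ :: "nat \<Rightarrow> 'q \<Rightarrow> 'q" and eQ :: "'q \<Rightarrow> 'm"
    and k :: nat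
  assumes "cring R"
    and "assoc_algebra R A"
    and "free_module R A"
    and "ideal I A"
    and "left_module A M"
    and "free_module R (restrict_scalars R A M)"
    and "rel_projective_resolution R A M P dP eP"
    and "projective_resolution A M Q dQ eQ"
  shows "Tor_of_resolution A (quotient_right_module A I) P dP k \<cong>
         Tor_of_resolution A (quotient_right_module A I) Q dQ k"
proof -
  have "rel_projective_resolution R A M Q dQ eQ"
    using assms(8) projective_resolution_R_split[OF assms(1,2,3,6,8)]
    by (simp add: rel_projective_resolution_def projective_resolution_def
        projective_imp_rel_projective)
  then show ?thesis
    by (rule Tor_independent_of_rel_projective_resolution
        [OF assms(2) quotient_right_module[OF assms(4)] assms(7)])
qed

end
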